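(* Let $r,s\in\mathbb{R}$ with $s\le r$, and consider strategic pairs for the classical vibrating string (as defined in the context) relative to $(r,s)$. (a) If $r-s<1$, there is no strategic pair. (b) If $r-s=1$, the set of strategic pairs has zero Lebesgue measure and full Hausdorff dimension (that is, Hausdorff dimension $2$) in $\mathbb{R}^2$. (c) If $r-s>1$, the set of strategic pairs has full Lebesgue measure in $\mathbb{R}^2$ (that is, its complement in $\mathbb{R}^2$ is Lebesgue-null).
   Context: Function spaces: let $D$ be the vector space of finite linear combinations $\sum_k c_k\sin(kx)$, $c_k\in\mathbb{C}$, $k=1,2,\ldots$, on $(0,\pi)$. For $s\in\mathbb{R}$, equip $D$ with the norm $\|\sum_k c_k\sin(kx)\|_s^2:=\sum_k k^{2s}|c_k|^2$, and let $D^s$ be the completion of $D$ for $\|\cdot\|_s$. Classical string: the problem $y''-y_{xx}=0$ in $\mathbb{R}\times(0,\pi)$, $y=0$ on $\mathbb{R}\times\{0,\pi\}$, $y(0)=y_0$, $y'(0)=y_1$ in $(0,\pi)$ (prime denotes the time derivative, $y(t)$ denotes $y(t,\cdot)$). For $\sigma\in\mathbb{R}$, $y_0\in D^\sigma$, $y_1\in D^{\sigma-1}$, its unique solution in $C(\mathbb{R},D^\sigma)\cap C^1(\mathbb{R},D^{\sigma-1})\cap C^2(\mathbb{R},D^{\sigma-2})$ is $y(t,x)=\sum_{k\ge1}(a_ke^{ikt}+b_ke^{-ikt})\sin kx$, where the complex numbers $a_k,b_k$ are determined by the initial data: $y_0=\sum_k(a_k+b_k)\sin kx$, $y_1=\sum_k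 ik(a_k-b_k)\sin kx$. Strategic pair: given real numbers $s\le r$, a pair $(t_0,t_1)\in\mathbb{R}^2$ is called strategic if there is a constant $c>0$ such that $\|y_0\|_s+\|y_1\|_{s-1}\le c(\|y(t_0)\|_r+\|y(t_1)\|_r)$ for all initial data $(y_0,y_1)\in D^r\times D^{r-1}$, where $y$ is the corresponding solution. *)

theory Defs
  imports "HOL-Analysis.Analysis"
begin

section \<open>The spaces \<open>D\<close> and \<open>D\<^sup>s\<close>\<close>

text \<open>
  A (formal) sine series \<open>\<Sum>k\<ge>1. c\<^sub>k sin (k x)\<close> on \<open>(0,\<pi>)\<close> is represented by its coefficient
  sequence \<open>c :: nat \<Rightarrow> complex\<close>. There is no term of index \<open>0\<close>, so \<open>c 0 = 0\<close> is required.
  The finite sums form \<open>D\<close>; the coefficients are determined by the function on \<open>(0,\<pi>)\<close>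
  (lemma \<open>sine_poly_inject\<close>), so nothing is lost by passing to coefficients.
\<close>

definition sine_D :: "(nat \<Rightarrow> complex) set" where
  "sine_D = {c. c 0 = 0 \<and> finite {k. c k \<noteq> 0}}"

definition sine_poly :: "(nat \<Rightarrow> complex) \<Rightarrow> real \<Rightarrow> complex" where
  "sine_poly c x = (\<Sum>k | c k \<noteq> 0. c k * of_real (sin (real k * x)))"

text \<open>
  The completion of \<open>D\<close> for the norm \<open>\<parallel>c\<parallel>\<^sub>s\<^sup>2 = \<Sum>k\<ge>1. k\<^sup>2\<^sup>s \<bar>c\<^sub>k\<bar>\<^sup>2\<close> is realised as the space of all
  coefficient sequences of finite norm; this makes the inclusions \<open>D\<^sup>r \<subseteq> D\<^sup>s\<close> (\<open>s \<le> r\<close>) literal.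
  The lemmas \<open>sine_D_subset\<close>, \<open>sine_D_dense\<close> and \<open>sine_space_complete\<close> show that it is the completion.
  The series below start at \<open>k = 0\<close>, where the term vanishes since \<open>0 powr a = 0\<close>.
\<close>

definition sine_space :: "real \<Rightarrow> (nat \<Rightarrow> complex) set" where
  "sine_space s = {c. c 0 = 0 \<and> summable (\<lambda>k. real k powr (2 * s) * (cmod (c k))\<^sup>2)}"

definition sine_norm :: "real \<Rightarrow> (nat \<Rightarrow> complex) \<Rightarrow> real" where
  "sine_norm s c = sqrt (\<Sum>k. real k powr (2 * s) * (cmod (c k))\<^sup>2)"


section \<open>The vibrating string\<close>

definition sine_continuous :: "real \<Rightarrow> (real \<Rightarrow> nat \<Rightarrow> complex) \<Rightarrow> bool" where
  "sine_continuous s y \<longleftrightarrow> (\<forall>t. y t \<in> sine_space s) \<and>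
     (\<forall>t. ((\<lambda>\<tau>. sine_norm s (\<lambda>k. y \<tau> k - y t k)) \<longlongrightarrow> 0) (at t))"

definition sine_has_derivative :: "real \<Rightarrow> (real \<Rightarrow> nat \<Rightarrow> complex) \<Rightarrow> (real \<Rightarrow> nat \<Rightarrow> complex) \<Rightarrow> bool" where
  "sine_has_derivative s y v \<longleftrightarrow>
     (\<forall>t. ((\<lambda>h. sine_norm s (\<lambda>k. (y (t + h) k - y t k) / of_real h - v t k)) \<longlongrightarrow> 0) (at 0))"

definition sine_dxx :: "(nat \<Rightarrow> complex) \<Rightarrow> nat \<Rightarrow> complex" where
  "sine_dxx c = (\<lambda>k. - (of_nat k)\<^sup>2 * c k)"

text \<open>
  \<open>y\<close> solves \<open>y'' = y\<^sub>x\<^sub>x\<close>, \<open>y(0) = y\<^sub>0\<close>, \<open>y'(0) = y\<^sub>1\<close> and belongs to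
  \<open>C(\<real>,D\<^sup>\<sigma>) \<inter> C\<^sup>1(\<real>,D\<^sup>\<sigma>\<^sup>-\<^sup>1) \<inter> C\<^sup>2(\<real>,D\<^sup>\<sigma>\<^sup>-\<^sup>2)\<close>; here \<open>v = y'\<close> and \<open>w = y''\<close>.
  The Dirichlet conditions at \<open>0\<close> and \<open>\<pi>\<close> are built into sine series.
  Well-posedness and the explicit form of the solution are lemma \<open>string_solution_iff\<close>.
\<close>

definition string_solution ::
  "real \<Rightarrow> (nat \<Rightarrow> complex) \<Rightarrow> (nat \<Rightarrow> complex) \<Rightarrow> (real \<Rightarrow> nat \<Rightarrow> complex) \<Rightarrow> bool" where
  "string_solution \<sigma> y0 y1 y \<longleftrightarrow>
     (\<exists>v w. sine_continuous \<sigma> y \<and> sine_continuous (\<sigma> - 1) v \<and> sine_continuous (\<sigma> - 2) w \<and>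
            sine_has_derivative (\<sigma> - 1) y v \<and> sine_has_derivative (\<sigma> - 2) v w \<and>
            (\<forall>t. w t = sine_dxx (y t)) \<and> y 0 = y0 \<and> v 0 = y1)"

definition strategic_pairs :: "real \<Rightarrow> real \<Rightarrow> (real \<times> real) set" where
  "strategic_pairs r s =
     {(t0, t1). \<exists>c>0. \<forall>y0\<in>sine_space r. \<forall>y1\<in>sine_space (r - 1). \<forall>y.
        string_solution r y0 y1 y \<longrightarrow>
        sine_norm s y0 + sine_norm (s - 1) y1 \<le> c * (sine_norm r (y t0) + sine_norm r (y t1))}"


section \<open>Hausdorff dimension\<close>

text \<open>The convention is \<open>0\<^sup>0 = 1\<close> for nonempty sets of diameter \<open>0\<close>, whereas \<open>0 powr 0 = 0\<close>.\<close>

definition diam_pow :: "real \<Rightarrow> 'a::metric_space set \<Rightarrow> ennreal" where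
  "diam_pow d U = (if U = {} then 0 else if d = 0 then 1 else ennreal (diameter U powr d))"

text \<open>Boundedness has to be imposed since \<open>diameter\<close> is meaningless for unbounded sets.\<close>

definition hausdorff_pre_measure :: "real \<Rightarrow> real \<Rightarrow> 'a::metric_space set \<Rightarrow> ennreal" where
  "hausdorff_pre_measure d \<delta> E =
     (INF U \<in> {U :: nat \<Rightarrow> 'a set. E \<subseteq> (\<Union>i. U i) \<and> (\<forall>i. bounded (U i) \<and> diameter (U i) \<le> \<delta>)}.
        \<Sum>i. diam_pow d (U i))"

definition hausdorff_measure :: "real \<Rightarrow> 'a::metric_space set \<Rightarrow> ennreal" where
  "hausdorff_measure d E = (SUP \<delta>\<in>{0<..}. hausdorff_pre_measure d \<delta> E)"

definition hausdorff_dim :: "'a::metric_space set \<Rightarrow> ennreal" where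
  "hausdorff_dim E = Inf {ennreal d | d. 0 \<le> d \<and> hausdorff_measure d E = 0}"


section \<open>\<open>D\<^sup>s\<close> is the completion of \<open>D\<close>\<close>

abbreviation (input) sine_term :: "real \<Rightarrow> (nat \<Rightarrow> complex) \<Rightarrow> nat \<Rightarrow> real" where
  "sine_term s c k \<equiv> real k powr (2 * s) * (cmod (c k))\<^sup>2"

lemma sine_D_subset: "sine_D \<subseteq> sine_space s"
proof
  fix c assume c: "c \<in> sine_D"
  have "summable (sine_term s c)"
    by (rule summable_finite[of "{k. c k \<noteq> 0}"]) (use c in \<open>auto simp: sine_D_def\<close>)
  then show "c \<in> sine_space s"
    using c by (simp add: sine_D_def sine_space_def)
qed

lemma sine_D_dense:
  assumes c: "c \<in> sine_space s" and e: "e > 0"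
  shows "\<exists>d\<in>sine_D. sine_norm s (\<lambda>k. c k - d k) < e"
proof -
  have sm: "summable (sine_term s c)" using c by (simp add: sine_space_def)
  obtain N where N: "\<And>n. n \<ge> N \<Longrightarrow> norm (\<Sum>i. sine_term s c (i + n)) < e\<^sup>2"
    using suminf_exist_split[OF _ sm, of "e\<^sup>2"] e by auto
  define d where "d = (\<lambda>k. if k < N then c k else 0)"
  have "{k. d k \<noteq> 0} \<subseteq> {..<N}" by (auto simp: d_def)
  then have "d \<in> sine_D"
    using c finite_subset by (auto simp: sine_D_def sine_space_def d_def)
  moreover
  have eq: "sine_term s (\<lambda>k. c k - d k) = (\<lambda>k. if k < N then 0 else sine_term s c k)"
    by (auto simp: d_def)
  have "summable (\<lambda>k. if k < N then 0 else sine_term s c k)"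
    by (rule summable_comparison_test'[OF sm, of 0]) auto
  from suminf_split_initial_segment[OF this, of N]
  have "(\<Sum>k. sine_term s (\<lambda>k. c k - d k) k) = (\<Sum>i. sine_term s c (i + N))"
    unfolding eq by simp
  with N[of N] have "(\<Sum>k. sine_term s (\<lambda>k. c k - d k) k) < e\<^sup>2" by simp
  then have "sine_norm s (\<lambda>k. c k - d k) < e"
    unfolding sine_norm_def using e
    by (metis abs_of_pos real_sqrt_abs real_sqrt_less_iff)
  ultimately show ?thesis by blast
qed

lemma sine_term_add_le:
  "sine_term s (\<lambda>k. a k + b k) k \<le> 2 * sine_term s a k + 2 * sine_term s b k"
proof -
  have "(cmod (a k + b k))\<^sup>2 \<le> (cmod (a k) + cmod (b k))\<^sup>2"
    by (intro power_mono norm_triangle_ineq) auto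
  also have "\<dots> \<le> 2 * (cmod (a k))\<^sup>2 + 2 * (cmod (b k))\<^sup>2"
    using sum_squares_bound[of "cmod (a k)" "cmod (b k)"] by (simp add: power2_sum)
  finally have *: "(cmod (a k + b k))\<^sup>2 \<le> 2 * (cmod (a k))\<^sup>2 + 2 * (cmod (b k))\<^sup>2" .
  have "real k powr (2 * s) * (cmod (a k + b k))\<^sup>2
      \<le> real k powr (2 * s) * (2 * (cmod (a k))\<^sup>2 + 2 * (cmod (b k))\<^sup>2)"
    using * by (rule mult_left_mono) simp
  then show ?thesis by (simp add: algebra_simps)
qed

lemma sine_space_add:
  assumes "a \<in> sine_space s" "b \<in> sine_space s"
  shows "(\<lambda>k. a k + b k) \<in> sine_space s"
proof -
  have "summable (\<lambda>k. 2 * sine_term s a k + 2 * sine_term s b k)"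
    using assms by (auto simp: sine_space_def intro!: summable_add summable_mult)
  then have "summable (sine_term s (\<lambda>k. a k + b k))"
    by (rule summable_comparison_test'[of _ 0]) (use sine_term_add_le in auto)
  then show ?thesis using assms by (simp add: sine_space_def)
qed

lemma sine_space_scale:
  assumes "a \<in> sine_space s"
  shows "(\<lambda>k. z * a k) \<in> sine_space s"
proof -
  have "summable (\<lambda>k. (cmod z)\<^sup>2 * sine_term s a k)"
    using assms by (auto simp: sine_space_def intro!: summable_mult)
  then have "summable (sine_term s (\<lambda>k. z * a k))"
    by (simp add: norm_mult power_mult_distrib mult_ac)
  then show ?thesis using assms by (simp add: sine_space_def)
qed

lemma sine_space_diff:
  assumes "a \<in> sine_space s" "b \<in> sine_space s"
  shows "(\<lambda>k. a k - b k) \<in> sine_space s"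
  using sine_space_add[OF assms(1) sine_space_scale[OF assms(2), of "-1"]] by simp

lemma sine_space_mono:
  assumes "s \<le> r"
  shows "sine_space r \<subseteq> sine_space s"
proof
  fix c assume c: "c \<in> sine_space r"
  have "sine_term s c k \<le> sine_term r c k" for k
  proof (cases "k = 0")
    case False
    then have "real k powr (2 * s) \<le> real k powr (2 * r)"
      using assms by (intro powr_mono) auto
    then show ?thesis by (rule mult_right_mono) simp
  qed simp
  moreover have "summable (sine_term r c)" using c by (simp add: sine_space_def)
  ultimately have "summable (sine_term s c)"
    by (auto intro: summable_comparison_test_ev[of _ "sine_term r c"])
  with c show "c \<in> sine_space s" by (simp add: sine_space_def)
qed

lemma sine_norm_power2:
  assumes "c \<in> sine_space s"
  shows "(sine_norm s c)\<^sup>2 = (\<Sum>k. sine_term s c k)"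
  unfolding sine_norm_def
  using assms by (intro real_sqrt_pow2 suminf_nonneg) (auto simp: sine_space_def)

lemma sine_norm_coeff_le:
  assumes c: "c \<in> sine_space s"
  shows "real k powr s * cmod (c k) \<le> sine_norm s c"
proof -
  have "(\<Sum>i\<in>{k}. sine_term s c i) \<le> (\<Sum>i. sine_term s c i)"
    using c by (intro sum_le_suminf) (auto simp: sine_space_def)
  then have "sqrt (sine_term s c k) \<le> sine_norm s c"
    unfolding sine_norm_def by simp
  moreover have "sqrt (sine_term s c k) = real k powr s * cmod (c k)"
  proof -
    have "real k powr (2 * s) = (real k powr s)\<^sup>2"
      by (simp add: power2_eq_square flip: powr_add)
    then show ?thesis by (simp add: real_sqrt_mult)
  qed
  ultimately show ?thesis by simp
qed

lemma sine_space_complete: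
  assumes f: "\<And>n. f n \<in> sine_space s"
    and cauchy: "\<And>e. e > 0 \<Longrightarrow> \<exists>N. \<forall>m\<ge>N. \<forall>n\<ge>N. sine_norm s (\<lambda>k. f m k - f n k) < e"
  shows "\<exists>c\<in>sine_space s. (\<lambda>n. sine_norm s (\<lambda>k. f n k - c k)) \<longlonglongrightarrow> 0"
proof -
  have diff: "(\<lambda>k. f m k - f n k) \<in> sine_space s" for m n
    by (intro sine_space_diff f)
  have "Cauchy (\<lambda>n. f n k)" for k
  proof (cases "k = 0")
    case True
    then have "(\<lambda>n. f n k) = (\<lambda>n. 0)" using f by (auto simp: sine_space_def)
    then show ?thesis by (simp add: convergent_Cauchy convergent_const)
  next
    case False
    show ?thesis
    proof (rule CauchyI)
      fix e :: real assume e: "e > 0"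
      then obtain N where N: "\<forall>m\<ge>N. \<forall>n\<ge>N. sine_norm s (\<lambda>k. f m k - f n k) < real k powr s * e"
        using cauchy[of "real k powr s * e"] False by auto
      have "norm (f m k - f n k) < e" if "m \<ge> N" "n \<ge> N" for m n
      proof -
        have "real k powr s * norm (f m k - f n k) < real k powr s * e"
          using sine_norm_coeff_le[OF diff[of m n], of k] N that by (meson le_less_trans)
        then show ?thesis using False by simp
      qed
      then show "\<exists>M. \<forall>m\<ge>M. \<forall>n\<ge>M. norm (f m k - f n k) < e" by blast
    qed
  qed
  then have "\<forall>k. \<exists>l. (\<lambda>n. f n k) \<longlonglongrightarrow> l"
    by (simp add: Cauchy_convergent_iff convergent_def)
  then obtain c where c: "\<And>k. (\<lambda>n. f n k) \<longlonglongrightarrow> c k" by metis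
  have c0: "c 0 = 0"
    using c[of 0] f by (simp add: sine_space_def LIMSEQ_const_iff)
  have key: "\<exists>N. \<forall>n\<ge>N. (\<lambda>k. f n k - c k) \<in> sine_space s \<and> sine_norm s (\<lambda>k. f n k - c k) \<le> e"
    if e: "e > 0" for e
  proof -
    obtain N where N: "\<forall>m\<ge>N. \<forall>n\<ge>N. sine_norm s (\<lambda>k. f m k - f n k) < e"
      using cauchy[OF e] by blast
    have "(\<lambda>k. f n k - c k) \<in> sine_space s \<and> sine_norm s (\<lambda>k. f n k - c k) \<le> e" if n: "n \<ge> N" for n
    proof -
      have bnd: "(\<Sum>k<K. sine_term s (\<lambda>k. f n k - c k) k) \<le> e\<^sup>2" for K
      proof (rule LIMSEQ_le_const2)
        show "(\<lambda>m. \<Sum>k<K. sine_term s (\<lambda>k. f n k - f m k) k)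
                \<longlonglongrightarrow> (\<Sum>k<K. sine_term s (\<lambda>k. f n k - c k) k)"
          by (intro tendsto_intros c)
        have "(\<Sum>k<K. sine_term s (\<lambda>k. f n k - f m k) k) \<le> e\<^sup>2" if m: "m \<ge> N" for m
        proof -
          have "(\<Sum>k<K. sine_term s (\<lambda>k. f n k - f m k) k) \<le> (\<Sum>k. sine_term s (\<lambda>k. f n k - f m k) k)"
            using diff[of n m] by (intro sum_le_suminf) (auto simp: sine_space_def)
          also have "\<dots> = (sine_norm s (\<lambda>k. f n k - f m k))\<^sup>2"
            by (rule sine_norm_power2[OF diff, symmetric])
          also have "\<dots> \<le> e\<^sup>2"
          proof (rule power_mono)
            show "sine_norm s (\<lambda>k. f n k - f m k) \<le> e" using N n m by (simp add: less_imp_le)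
            show "0 \<le> sine_norm s (\<lambda>k. f n k - f m k)"
              using diff[of n m] by (auto simp: sine_norm_def sine_space_def intro!: suminf_nonneg)
          qed
          finally show ?thesis .
        qed
        then show "\<exists>M. \<forall>m\<ge>M. (\<Sum>k<K. sine_term s (\<lambda>k. f n k - f m k) k) \<le> e\<^sup>2" by blast
      qed
      have sm: "summable (sine_term s (\<lambda>k. f n k - c k))"
        by (rule bounded_imp_summable[of _ "e\<^sup>2"]) (use bnd[of "Suc _"] in \<open>auto simp: lessThan_Suc_atMost\<close>)
      have "(\<Sum>k. sine_term s (\<lambda>k. f n k - c k) k) \<le> e\<^sup>2"
        by (rule suminf_le_const[OF sm bnd])
      then have "sine_norm s (\<lambda>k. f n k - c k) \<le> e"
        unfolding sine_norm_def using e by (simp add: real_le_lsqrt suminf_nonneg[OF sm])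
      moreover have "(\<lambda>k. f n k - c k) \<in> sine_space s"
        using sm c0 f[of n] by (simp add: sine_space_def)
      ultimately show ?thesis by blast
    qed
    then show ?thesis by blast
  qed
  obtain N where "(\<lambda>k. f N k - c k) \<in> sine_space s" using key[of 1] by auto
  from sine_space_diff[OF f[of N] this] have "c \<in> sine_space s" by simp
  moreover have "(\<lambda>n. sine_norm s (\<lambda>k. f n k - c k)) \<longlonglongrightarrow> 0"
  proof (rule LIMSEQ_I)
    fix e :: real assume e: "e > 0"
    then obtain N where N: "\<forall>n\<ge>N. (\<lambda>k. f n k - c k) \<in> sine_space s \<and> sine_norm s (\<lambda>k. f n k - c k) \<le> e/2"
      using key[of "e/2"] by auto
    have "norm (sine_norm s (\<lambda>k. f n k - c k) - 0) < e" if "n \<ge> N" for n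
    proof -
      have "0 \<le> sine_norm s (\<lambda>k. f n k - c k)"
        using N that unfolding sine_norm_def
        by (auto simp: sine_space_def intro!: suminf_nonneg)
      then show ?thesis using N that e by fastforce
    qed
    then show "\<exists>N. \<forall>n\<ge>N. norm (sine_norm s (\<lambda>k. f n k - c k) - 0) < e" by blast
  qed
  ultimately show ?thesis by blast
qed

lemma has_integral_sin_sin:
  fixes k l :: nat
  assumes "k \<noteq> 0" "l \<noteq> 0"
  shows "((\<lambda>x. sin (real k * x) * sin (real l * x)) has_integral (if k = l then pi / 2 else 0)) {0..pi}"
proof (cases "k = l")
  case True
  define F where "F = (\<lambda>x::real. x / 2 - sin (2 * real k * x) / (4 * real k))"
  have "((\<lambda>x. sin (real k * x) * sin (real l * x)) has_integral (F pi - F 0)) {0..pi}"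
  proof (rule fundamental_theorem_of_calculus)
    fix x
    have "sin (real k * x) * sin (real l * x) = 1/2 - cos (2 * real k * x) / 2"
      using cos_double_sin[of "real k * x"] True by (simp add: power2_eq_square mult_ac diff_divide_distrib)
    moreover have "(F has_real_derivative 1/2 - cos (2 * real k * x) / 2) (at x within {0..pi})"
      unfolding F_def using assms by (auto intro!: derivative_eq_intros)
    ultimately show "(F has_vector_derivative sin (real k * x) * sin (real l * x)) (at x within {0..pi})"
      by (simp add: has_real_derivative_iff_has_vector_derivative)
  qed simp
  moreover have "sin (2 * real k * pi) = 0"
    using sin_npi[of "2 * k"] by simp
  ultimately show ?thesis using True by (simp add: F_def)
next
  case False
  define a b where "a = real k - real l" and "b = real k + real l"
  have ab: "a \<noteq> 0" "b \<noteq> 0" using False assms by (auto simp: a_def b_def)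
  define F where "F = (\<lambda>x::real. sin (a * x) / (2 * a) - sin (b * x) / (2 * b))"
  have "((\<lambda>x. sin (real k * x) * sin (real l * x)) has_integral (F pi - F 0)) {0..pi}"
  proof (rule fundamental_theorem_of_calculus)
    fix x
    have "sin (real k * x) * sin (real l * x) = cos (a * x) / 2 - cos (b * x) / 2"
      by (simp add: sin_times_sin a_def b_def algebra_simps diff_divide_distrib)
    moreover have "(F has_real_derivative cos (a * x) / 2 - cos (b * x) / 2) (at x within {0..pi})"
      unfolding F_def using ab by (auto intro!: derivative_eq_intros)
    ultimately show "(F has_vector_derivative sin (real k * x) * sin (real l * x)) (at x within {0..pi})"
      by (simp add: has_real_derivative_iff_has_vector_derivative)
  qed simp
  moreover have "sin (a * pi) = 0" "sin (b * pi) = 0"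
    using sin_int_times_real[of "int k - int l"] sin_npi[of "k + l"]
    by (simp_all add: a_def b_def sin_zero_iff_int2 exI[of _ "int k - int l"])
  ultimately show ?thesis using False by (simp add: F_def)
qed

lemma sine_poly_inject:
  assumes c: "c \<in> sine_D" and d: "d \<in> sine_D"
    and eq: "\<And>x. 0 < x \<Longrightarrow> x < pi \<Longrightarrow> sine_poly c x = sine_poly d x"
  shows "c = d"
proof
  fix l
  define K where "K = {k. c k \<noteq> 0} \<union> {k. d k \<noteq> 0}"
  have K: "finite K" "0 \<notin> K" using c d by (auto simp: K_def sine_D_def)
  have sum: "sine_poly e x = (\<Sum>k\<in>K. e k * of_real (sin (real k * x)))"
    if "{k. e k \<noteq> 0} \<subseteq> K" for e x
    unfolding sine_poly_def by (rule sum.mono_neutral_left) (use K that in auto)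
  have zero: "(\<Sum>k\<in>K. (c k - d k) * of_real (sin (real k * x))) = 0" if "x \<in> {0..pi}" for x
  proof (cases "x = 0 \<or> x = pi")
    case True
    then show ?thesis by (auto intro!: sum.neutral)
  next
    case False
    then have "sine_poly c x = sine_poly d x" using eq that by auto
    then show ?thesis
      using sum[of c x] sum[of d x] by (simp add: K_def left_diff_distrib sum_subtractf)
  qed
  show "c l = d l"
  proof (cases "l \<in> K")
    case False
    then show ?thesis by (simp add: K_def)
  next
    case True
    then have l: "l \<noteq> 0" using K by metis
    have "((\<lambda>x. \<Sum>k\<in>K. (c k - d k) * of_real (sin (real k * x) * sin (real l * x))) has_integral
            (\<Sum>k\<in>K. (c k - d k) * of_real (if k = l then pi / 2 else 0))) {0..pi}"
    proof (intro has_integral_sum K has_integral_mult_right)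
      fix k assume "k \<in> K"
      then have "k \<noteq> 0" using K by metis
      then show "((\<lambda>x. complex_of_real (sin (real k * x) * sin (real l * x))) has_integral
          complex_of_real (if k = l then pi / 2 else 0)) {0..pi}"
        using has_integral_linear[OF has_integral_sin_sin[of k l] bounded_linear_of_real[where 'a=complex]] l
        by (simp add: o_def)
    qed
    moreover have "(\<Sum>k\<in>K. (c k - d k) * of_real (sin (real k * x) * sin (real l * x))) = 0"
      if "x \<in> {0..pi}" for x
    proof -
      have "(\<Sum>k\<in>K. (c k - d k) * of_real (sin (real k * x) * sin (real l * x)))
          = (\<Sum>k\<in>K. (c k - d k) * of_real (sin (real k * x))) * of_real (sin (real l * x))"
        by (simp add: sum_distrib_right mult.assoc)
      then show ?thesis using zero[OF that] by simp
    qed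
    ultimately have "((\<lambda>x. 0) has_integral
            (\<Sum>k\<in>K. (c k - d k) * of_real (if k = l then pi / 2 else 0))) {0..pi}"
      by (metis (no_types, lifting) has_integral_cong)
    then have "(\<Sum>k\<in>K. (c k - d k) * of_real (if k = l then pi / 2 else 0)) = 0"
      using has_integral_unique has_integral_0 by blast
    moreover have "(\<Sum>k\<in>K. (c k - d k) * complex_of_real (if k = l then pi / 2 else 0))
        = (\<Sum>k\<in>K. if k = l then (c k - d k) * complex_of_real (pi / 2) else 0)"
      by (intro sum.cong) auto
    ultimately show ?thesis using True K by (simp add: sum.delta)
  qed
qed


section \<open>Well-posedness of the string equation\<close>

definition string_a :: "(nat \<Rightarrow> complex) \<Rightarrow> (nat \<Rightarrow> complex) \<Rightarrow> nat \<Rightarrow> complex" where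
  "string_a y0 y1 k = (y0 k + y1 k / (\<i> * of_nat k)) / 2"

definition string_b :: "(nat \<Rightarrow> complex) \<Rightarrow> (nat \<Rightarrow> complex) \<Rightarrow> nat \<Rightarrow> complex" where
  "string_b y0 y1 k = (y0 k - y1 k / (\<i> * of_nat k)) / 2"

definition wave :: "(nat \<Rightarrow> complex) \<Rightarrow> (nat \<Rightarrow> complex) \<Rightarrow> real \<Rightarrow> nat \<Rightarrow> complex" where
  "wave a b t k = a k * cis (real k * t) + b k * cis (- (real k * t))"

lemma sine_norm_tendsto_zero:
  fixes g :: "real \<Rightarrow> nat \<Rightarrow> complex"
  assumes lim: "\<And>k. ((\<lambda>h. g h k) \<longlongrightarrow> 0) (at t)"
    and bnd: "\<And>h k. h \<noteq> t \<Longrightarrow> sine_term s (g h) k \<le> M k"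
    and M: "summable M"
  shows "((\<lambda>h. sine_norm s (g h)) \<longlongrightarrow> 0) (at t)"
proof -
  have "((\<lambda>h. \<Sum>k. sine_term s (g h) k) \<longlongrightarrow> (\<Sum>k. 0)) (at t)"
  proof (rule tannerys_theorem[where M = M, THEN conjunct2, THEN conjunct2])
    show "((\<lambda>h. sine_term s (g h) k) \<longlongrightarrow> 0) (at t)" for k
      using tendsto_mult[OF tendsto_const tendsto_power[OF tendsto_norm[OF lim[of k]], of 2]]
      by simp
    have "eventually (\<lambda>h. h \<noteq> t) (at t)"
      by (simp add: eventually_at_filter)
    then show "eventually (\<lambda>(k, h). norm (sine_term s (g h) k) \<le> M k) (at_top \<times>\<^sub>F at t)"
      unfolding eventually_prod_filter using bnd
      by (intro exI[of _ "\<lambda>_. True"] exI[of _ "\<lambda>h. h \<noteq> t"]) auto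
  qed (use M in auto)
  then show ?thesis
    unfolding sine_norm_def using tendsto_real_sqrt[of _ 0] by fastforce
qed

lemma cmod_cis_diff_le: "cmod (cis x - cis y) \<le> \<bar>x - y\<bar>"
proof -
  have "cis x - cis y = cis y * (cis (x - y) - 1)"
    by (simp add: cis_mult right_diff_distrib)
  then have "cmod (cis x - cis y) = cmod (cis (x - y) - 1)"
    by (simp add: norm_mult)
  also have "\<dots> = cmod (exp (\<i> * of_real (x - y)) - 1)"
    by (simp add: cis_conv_exp)
  also have "\<dots> \<le> \<bar>x - y\<bar>"
    using dist_exp_i_1[of "x - y"] abs_sin_x_le_abs_x[of "(x - y) / 2"] by simp
  finally show ?thesis .
qed

lemma sine_space_cis:
  assumes "a \<in> sine_space s"
  shows "(\<lambda>k. a k * cis (f k)) \<in> sine_space s"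
  using assms by (simp add: sine_space_def norm_mult)

lemma wave_continuous:
  assumes a: "a \<in> sine_space s" and b: "b \<in> sine_space s"
  shows "sine_continuous s (wave a b)"
  unfolding sine_continuous_def
proof (intro conjI allI)
  fix t
  show "wave a b t \<in> sine_space s"
    unfolding wave_def using sine_space_add[OF sine_space_cis[OF a] sine_space_cis[OF b]] by simp
  show "((\<lambda>\<tau>. sine_norm s (\<lambda>k. wave a b \<tau> k - wave a b t k)) \<longlongrightarrow> 0) (at t)"
  proof (rule sine_norm_tendsto_zero)
    fix k
    have "((\<lambda>\<tau>. wave a b \<tau> k) \<longlongrightarrow> wave a b t k) (at t)"
      unfolding wave_def by (intro tendsto_intros)
    then show "((\<lambda>\<tau>. wave a b \<tau> k - wave a b t k) \<longlongrightarrow> 0) (at t)"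
      using LIM_zero by blast
  next
    fix \<tau> k
    have le: "sine_term s (\<lambda>k. e k * (cis (u k) - cis (v k))) k \<le> 4 * sine_term s e k"
      for e :: "nat \<Rightarrow> complex" and u v
    proof -
      have "cmod (cis (u k) - cis (v k)) \<le> 2"
        using norm_triangle_ineq4[of "cis (u k)" "cis (v k)"] by simp
      then have "(cmod (cis (u k) - cis (v k)))\<^sup>2 \<le> 2\<^sup>2" by (intro power_mono) auto
      then have "sine_term s e k * (cmod (cis (u k) - cis (v k)))\<^sup>2 \<le> sine_term s e k * 4"
        by (intro mult_left_mono) auto
      then show ?thesis by (simp add: norm_mult power_mult_distrib mult_ac)
    qed
    have "wave a b \<tau> k - wave a b t k = a k * (cis (real k * \<tau>) - cis (real k * t))
        + b k * (cis (- (real k * \<tau>)) - cis (- (real k * t)))"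
      by (simp add: wave_def algebra_simps)
    then show "sine_term s (\<lambda>k. wave a b \<tau> k - wave a b t k) k
        \<le> 2 * (4 * sine_term s a k) + 2 * (4 * sine_term s b k)"
      using sine_term_add_le[of k s "\<lambda>k. a k * (cis (real k * \<tau>) - cis (real k * t))"
          "\<lambda>k. b k * (cis (- (real k * \<tau>)) - cis (- (real k * t)))"]
        le[of a "\<lambda>k. real k * \<tau>" "\<lambda>k. real k * t"]
        le[of b "\<lambda>k. - (real k * \<tau>)" "\<lambda>k. - (real k * t)"]
      by simp
  next
    show "summable (\<lambda>k. 2 * (4 * sine_term s a k) + 2 * (4 * sine_term s b k))"
      using a b by (intro summable_add summable_mult) (auto simp: sine_space_def)
  qed
qed

lemma has_vector_derivative_quotient:
  fixes f :: "real \<Rightarrow> complex"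
  shows "(f has_vector_derivative D) (at t) \<longleftrightarrow>
           ((\<lambda>h. (f (t + h) - f t) / of_real h - D) \<longlongrightarrow> 0) (at 0)"
proof -
  have eq: "norm (f (t + h) - f t - h *\<^sub>R D) / norm h = norm ((f (t + h) - f t) / of_real h - D)"
    if "h \<noteq> 0" for h
  proof -
    have "(f (t + h) - f t) / of_real h - D = (f (t + h) - f t - h *\<^sub>R D) / of_real h"
      using that by (simp add: field_simps scaleR_conv_of_real)
    then show ?thesis by (simp add: norm_divide)
  qed
  have "(f has_vector_derivative D) (at t) \<longleftrightarrow>
          ((\<lambda>h. norm (f (t + h) - f t - h *\<^sub>R D) / norm h) \<longlongrightarrow> 0) (at 0)"
    by (simp add: has_vector_derivative_def has_derivative_at bounded_linear_scaleR_left)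
  also have "\<dots> \<longleftrightarrow> ((\<lambda>h. norm ((f (t + h) - f t) / of_real h - D)) \<longlongrightarrow> 0) (at 0)"
    by (intro filterlim_cong refl) (auto simp: eventually_at_filter simp flip: eq)
  also have "\<dots> \<longleftrightarrow> ((\<lambda>h. (f (t + h) - f t) / of_real h - D) \<longlongrightarrow> 0) (at 0)"
    by (rule tendsto_norm_zero_iff)
  finally show ?thesis .
qed

lemma wave_coeff_derivative:
  "((\<lambda>t. wave a b t k) has_vector_derivative
      wave (\<lambda>k. \<i> * of_nat k * a k) (\<lambda>k. - (\<i> * of_nat k * b k)) t k) (at t)"
proof -
  have "((\<lambda>x. cis (m * x)) has_vector_derivative (m *\<^sub>R (\<i> * cis (m * t)))) (at t)" for m :: real
    by (auto simp: has_vector_derivative_def intro!: derivative_eq_intros)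
  from this[of "real k"] this[of "- real k"] show ?thesis
    unfolding wave_def
    by (auto intro!: derivative_eq_intros simp: scaleR_conv_of_real algebra_simps)
qed

lemma sine_space_deriv:
  assumes a: "a \<in> sine_space s" and z: "cmod z = 1"
  shows "(\<lambda>k. z * of_nat k * a k) \<in> sine_space (s - 1)"
proof -
  have "sine_term (s - 1) (\<lambda>k. z * of_nat k * a k) = sine_term s a"
  proof
    fix k
    show "sine_term (s - 1) (\<lambda>k. z * of_nat k * a k) k = sine_term s a k"
    proof (cases "k = 0")
      case False
      then have "real k powr (2 * s) = real k powr (2 * (s - 1)) * (real k)\<^sup>2"
        by (simp add: powr_add[symmetric] right_diff_distrib flip: powr_numeral)
      then show ?thesis using z by (simp add: norm_mult power_mult_distrib)
    qed simp
  qed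
  then show ?thesis using a by (simp add: sine_space_def)
qed

lemma wave_derivative:
  assumes a: "a \<in> sine_space s" and b: "b \<in> sine_space s"
  shows "sine_has_derivative (s - 1) (wave a b)
           (wave (\<lambda>k. \<i> * of_nat k * a k) (\<lambda>k. - (\<i> * of_nat k * b k)))"
  unfolding sine_has_derivative_def
proof (intro allI, rule sine_norm_tendsto_zero)
  fix t k
  let ?v = "wave (\<lambda>k. \<i> * of_nat k * a k) (\<lambda>k. - (\<i> * of_nat k * b k))"
  show "((\<lambda>h. (wave a b (t + h) k - wave a b t k) / of_real h - ?v t k) \<longlongrightarrow> 0) (at 0)"
    using wave_coeff_derivative[of a b k t] by (simp add: has_vector_derivative_quotient)
next
  fix t h k assume h: "h \<noteq> (0::real)"
  let ?v = "wave (\<lambda>k. \<i> * of_nat k * a k) (\<lambda>k. - (\<i> * of_nat k * b k))"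
  define p where "p = (\<lambda>k. (cis (real k * (t + h)) - cis (real k * t)) / of_real h - \<i> * of_nat k * cis (real k * t))"
  define q where "q = (\<lambda>k. (cis (- (real k * (t + h))) - cis (- (real k * t))) / of_real h + \<i> * of_nat k * cis (- (real k * t)))"
  have quot: "cmod ((cis x - cis y) / of_real h) \<le> real k" if "\<bar>x - y\<bar> = real k * \<bar>h\<bar>" for x y
    using cmod_cis_diff_le[of x y] that h by (simp add: norm_divide field_simps)
  have p: "cmod (p k) \<le> 2 * real k"
  proof -
    have "cmod (p k) \<le> cmod ((cis (real k * (t + h)) - cis (real k * t)) / of_real h) + cmod (\<i> * of_nat k * cis (real k * t))"
      unfolding p_def by (rule norm_triangle_ineq4)
    also have "\<dots> \<le> real k + real k"
      by (intro add_mono quot) (auto simp: norm_mult algebra_simps abs_mult)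
    finally show ?thesis by simp
  qed
  have q: "cmod (q k) \<le> 2 * real k"
  proof -
    have "cmod (q k) \<le> cmod ((cis (- (real k * (t + h))) - cis (- (real k * t))) / of_real h) + cmod (\<i> * of_nat k * cis (- (real k * t)))"
      unfolding q_def by (rule norm_triangle_ineq)
    also have "\<dots> \<le> real k + real k"
      by (intro add_mono quot) (auto simp: norm_mult algebra_simps abs_mult)
    finally show ?thesis by simp
  qed
  have le: "sine_term (s - 1) (\<lambda>k. e k * u k) k \<le> 4 * sine_term s e k"
    if u: "cmod (u k) \<le> 2 * real k" for e u :: "nat \<Rightarrow> complex"
  proof (cases "k = 0")
    case False
    have eq: "real k powr (2 * s) = real k powr (2 * (s - 1)) * (real k)\<^sup>2"
      using False by (simp add: powr_add[symmetric] right_diff_distrib flip: powr_numeral)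
    have "(cmod (u k))\<^sup>2 \<le> (2 * real k)\<^sup>2" using u by (intro power_mono) auto
    then have "sine_term (s - 1) e k * (cmod (u k))\<^sup>2 \<le> sine_term (s - 1) e k * (2 * real k)\<^sup>2"
      by (intro mult_left_mono) auto
    then show ?thesis unfolding eq by (simp add: norm_mult power_mult_distrib mult_ac)
  qed simp
  have "(wave a b (t + h) k - wave a b t k) / of_real h - ?v t k = a k * p k + b k * q k"
    using h by (simp add: wave_def p_def q_def field_simps)
  then show "sine_term (s - 1) (\<lambda>k. (wave a b (t + h) k - wave a b t k) / of_real h - ?v t k) k
      \<le> 2 * (4 * sine_term s a k) + 2 * (4 * sine_term s b k)"
    using sine_term_add_le[of k "s - 1" "\<lambda>k. a k * p k" "\<lambda>k. b k * q k"] le[where u = p and e = a, OF p] le[where u = q and e = b, OF q]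
    by simp
next
  show "summable (\<lambda>k. 2 * (4 * sine_term s a k) + 2 * (4 * sine_term s b k))"
    using a b by (intro summable_add summable_mult) (auto simp: sine_space_def)
qed

lemma sine_space_antideriv:
  assumes b: "b \<in> sine_space (s - 1)"
  shows "(\<lambda>k. b k / (\<i> * of_nat k)) \<in> sine_space s"
proof -
  have "sine_term s (\<lambda>k. b k / (\<i> * of_nat k)) = sine_term (s - 1) b"
  proof
    fix k
    show "sine_term s (\<lambda>k. b k / (\<i> * of_nat k)) k = sine_term (s - 1) b k"
    proof (cases "k = 0")
      case False
      then have "real k powr (2 * s) = real k powr (2 * (s - 1)) * (real k)\<^sup>2"
        by (simp add: powr_add[symmetric] right_diff_distrib flip: powr_numeral)
      then show ?thesis using False by (simp add: norm_mult norm_divide power_divide power_mult_distrib)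
    qed simp
  qed
  then show ?thesis using b by (simp add: sine_space_def)
qed

lemma sine_has_derivative_coeff:
  assumes y: "\<And>t. y t \<in> sine_space s" and v: "\<And>t. v t \<in> sine_space s"
    and der: "sine_has_derivative s y v"
  shows "((\<lambda>t. y t k) has_vector_derivative v t k) (at t)"
proof (cases "k = 0")
  case True
  then show ?thesis using y v by (simp add: sine_space_def)
next
  case False
  let ?q = "\<lambda>h k. (y (t + h) k - y t k) / of_real h - v t k"
  have "?q h \<in> sine_space s" for h
    using sine_space_diff[OF sine_space_scale[OF sine_space_diff[OF y y], of "inverse (of_real h)"] v]
    by (simp add: field_simps)
  from sine_norm_coeff_le[OF this]
  have le: "cmod (?q h k) \<le> sine_norm s (?q h) / real k powr s" for h
    using False by (simp add: field_simps)
  have "((\<lambda>h. sine_norm s (?q h) / real k powr s) \<longlongrightarrow> 0 / real k powr s) (at 0)"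
    using der False by (intro tendsto_divide tendsto_const) (auto simp: sine_has_derivative_def)
  then have "((\<lambda>h. ?q h k) \<longlongrightarrow> 0) (at 0)"
    by (intro Lim_null_comparison[OF always_eventually[OF allI[OF le]]]) simp
  then show ?thesis by (simp add: has_vector_derivative_quotient)
qed

lemma oscillator_unique:
  fixes f g :: "real \<Rightarrow> complex" and m :: real
  assumes f: "\<And>t. (f has_vector_derivative g t) (at t)"
    and g: "\<And>t. (g has_vector_derivative - (of_real m)\<^sup>2 * f t) (at t)"
  shows "2 * \<i> * of_real m * f t =
           (g 0 + \<i> * of_real m * f 0) * cis (m * t) - (g 0 - \<i> * of_real m * f 0) * cis (- (m * t))"
proof -
  have const: "(g t + \<i> * of_real n * f t) * cis (- (n * t)) = g 0 + \<i> * of_real n * f 0"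
    if n: "n\<^sup>2 = m\<^sup>2" for n :: real
  proof -
    let ?P = "\<lambda>t. (g t + \<i> * of_real n * f t) * cis (- (n * t))"
    have nm: "(complex_of_real m)\<^sup>2 = (of_real n)\<^sup>2"
      using n by (metis of_real_power)
    have cis': "((\<lambda>x. cis (- (n * x))) has_vector_derivative (- n) *\<^sub>R (\<i> * cis (- (n * t)))) (at t)" for t
      by (auto simp: has_vector_derivative_def intro!: derivative_eq_intros)
    have "(?P has_vector_derivative 0) (at t)" for t
      by (rule has_vector_derivative_eq_rhs,
          rule has_vector_derivative_mult[OF has_vector_derivative_add[OF g
            has_vector_derivative_mult[OF has_vector_derivative_const f]] cis'])
         (simp add: nm[unfolded power2_eq_square] scaleR_conv_of_real algebra_simps power2_eq_square)
    then obtain c where "\<And>x. x \<in> UNIV \<Longrightarrow> ?P x = c"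
      using has_vector_derivative_zero_constant[of UNIV ?P] by auto
    from this[of t] this[of 0] show ?thesis by simp
  qed
  have inv: "cis (m * t) * cis (- (m * t)) = 1" by (simp add: cis_mult)
  have plus: "(g t + \<i> * of_real m * f t) * cis (- (m * t)) = g 0 + \<i> * of_real m * f 0"
    using const[of m] by simp
  have minus: "(g t - \<i> * of_real m * f t) * cis (m * t) = g 0 - \<i> * of_real m * f 0"
    using const[of "- m"] by simp
  have "2 * \<i> * of_real m * f t =
      (g t + \<i> * of_real m * f t) * (cis (m * t) * cis (- (m * t)))
      - (g t - \<i> * of_real m * f t) * (cis (m * t) * cis (- (m * t)))"
    unfolding inv by (simp add: algebra_simps)
  also have "\<dots> = (g t + \<i> * of_real m * f t) * cis (- (m * t)) * cis (m * t)
      - (g t - \<i> * of_real m * f t) * cis (m * t) * cis (- (m * t))"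
    by (simp only: ac_simps)
  finally show ?thesis unfolding plus minus .
qed

text \<open>
  The unique solution is \<open>y(t,x) = \<Sum>k\<ge>1. (a\<^sub>k e\<^sup>i\<^sup>k\<^sup>t + b\<^sub>k e\<^sup>-\<^sup>i\<^sup>k\<^sup>t) sin (k x)\<close> with
  \<open>y\<^sub>0 = \<Sum>k. (a\<^sub>k + b\<^sub>k) sin (k x)\<close> and \<open>y\<^sub>1 = \<Sum>k. i k (a\<^sub>k - b\<^sub>k) sin (k x)\<close>.
\<close>

theorem string_solution_iff:
  assumes y0: "y0 \<in> sine_space \<sigma>" and y1: "y1 \<in> sine_space (\<sigma> - 1)"
  shows "string_solution \<sigma> y0 y1 y \<longleftrightarrow> y = wave (string_a y0 y1) (string_b y0 y1)"
proof
  assume "string_solution \<sigma> y0 y1 y"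
  then obtain v w where cont: "sine_continuous \<sigma> y" "sine_continuous (\<sigma> - 1) v" "sine_continuous (\<sigma> - 2) w"
    and der: "sine_has_derivative (\<sigma> - 1) y v" "sine_has_derivative (\<sigma> - 2) v w"
    and eq: "\<And>t. w t = sine_dxx (y t)" and init: "y 0 = y0" "v 0 = y1"
    unfolding string_solution_def by blast
  have mem: "y t \<in> sine_space (\<sigma> - 1)" "v t \<in> sine_space (\<sigma> - 1)"
       "v t \<in> sine_space (\<sigma> - 2)" "w t \<in> sine_space (\<sigma> - 2)" for t
    using cont sine_space_mono[of "\<sigma> - 1" \<sigma>] sine_space_mono[of "\<sigma> - 2" "\<sigma> - 1"]
    unfolding sine_continuous_def by auto
  have "y t k = wave (string_a y0 y1) (string_b y0 y1) t k" for t k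
  proof (cases "k = 0")
    case True
    then show ?thesis
      using y0 mem(1)[of t] by (simp add: wave_def string_a_def string_b_def sine_space_def)
  next
    case False
    have "((\<lambda>t. v t k) has_vector_derivative - (of_real (real k))\<^sup>2 * y t k) (at t)" for t
      using sine_has_derivative_coeff[OF mem(3,4) der(2), of k t] by (simp add: eq sine_dxx_def)
    from oscillator_unique[OF sine_has_derivative_coeff[OF mem(1,2) der(1), of k] this, of t]
    have "2 * \<i> * of_nat k * y t k = (y1 k + \<i> * of_nat k * y0 k) * cis (real k * t)
        - (y1 k - \<i> * of_nat k * y0 k) * cis (- (real k * t))"
      by (simp add: init)
    also have "\<dots> = 2 * \<i> * of_nat k * wave (string_a y0 y1) (string_b y0 y1) t k"
      using False by (simp add: wave_def string_a_def string_b_def field_simps)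
    finally show ?thesis using False by simp
  qed
  then show "y = wave (string_a y0 y1) (string_b y0 y1)" by blast
next
  assume y: "y = wave (string_a y0 y1) (string_b y0 y1)"
  define a b where "a = string_a y0 y1" and "b = string_b y0 y1"
  have a: "a \<in> sine_space \<sigma>"
    using sine_space_scale[OF sine_space_add[OF y0 sine_space_antideriv[OF y1]], of "1/2"]
    by (simp add: a_def string_a_def[abs_def])
  have b: "b \<in> sine_space \<sigma>"
    using sine_space_scale[OF sine_space_diff[OF y0 sine_space_antideriv[OF y1]], of "1/2"]
    by (simp add: b_def string_b_def[abs_def])
  define a' b' where "a' = (\<lambda>k. \<i> * of_nat k * a k)" and "b' = (\<lambda>k. - (\<i> * of_nat k * b k))"
  have a': "a' \<in> sine_space (\<sigma> - 1)" and b': "b' \<in> sine_space (\<sigma> - 1)"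
    using sine_space_deriv[OF a, of \<i>] sine_space_deriv[OF b, of "- \<i>"] by (simp_all add: a'_def b'_def)
  define a'' b'' where "a'' = (\<lambda>k. \<i> * of_nat k * a' k)" and "b'' = (\<lambda>k. - (\<i> * of_nat k * b' k))"
  have a'': "a'' \<in> sine_space (\<sigma> - 2)" and b'': "b'' \<in> sine_space (\<sigma> - 2)"
    using sine_space_deriv[OF a', of \<i>] sine_space_deriv[OF b', of "- \<i>"] by (simp_all add: a''_def b''_def)
  show "string_solution \<sigma> y0 y1 y"
    unfolding string_solution_def
  proof (intro exI conjI allI)
    show "sine_continuous \<sigma> y" "sine_continuous (\<sigma> - 1) (wave a' b')" "sine_continuous (\<sigma> - 2) (wave a'' b'')"
      using wave_continuous[OF a b] wave_continuous[OF a' b'] wave_continuous[OF a'' b'']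
      by (simp_all add: y a_def b_def)
    show "sine_has_derivative (\<sigma> - 1) y (wave a' b')"
      using wave_derivative[OF a b] by (simp add: y a_def b_def a'_def b'_def)
    show "sine_has_derivative (\<sigma> - 2) (wave a' b') (wave a'' b'')"
      using wave_derivative[OF a' b'] by (simp add: a''_def b''_def)
    show "wave a'' b'' t = sine_dxx (y t)" for t
    proof
      fix k
      have "wave a'' b'' t k = (\<i> * \<i>) * (of_nat k)\<^sup>2 * wave a b t k"
        unfolding wave_def a''_def b''_def a'_def b'_def by (simp only: power2_eq_square) algebra
      then show "wave a'' b'' t k = sine_dxx (y t) k"
        by (simp add: sine_dxx_def y a_def b_def)
    qed
    show "y 0 = y0"
    proof
      fix k show "y 0 k = y0 k"
        by (simp add: y wave_def string_a_def string_b_def add_divide_distrib[symmetric])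
    qed
    show "wave a' b' 0 = y1"
    proof
      fix k show "wave a' b' 0 k = y1 k"
        using y1 by (cases "k = 0")
          (auto simp: wave_def a'_def b'_def a_def b_def string_a_def string_b_def sine_space_def field_simps)
    qed
  qed
qed

end

theory Submission
  imports Defs
begin

text \<open>
  Write \<open>\<tau> = t\<^sub>1 - t\<^sub>0\<close> and \<open>\<delta> = r - s\<close>. On the mode \<open>k\<close> the string is a harmonic oscillator
  \<open>y\<^sub>k(t) = a\<^sub>k e\<^sup>i\<^sup>k\<^sup>t + b\<^sub>k e\<^sup>-\<^sup>i\<^sup>k\<^sup>t\<close>, and the two numbers \<open>y\<^sub>k(t\<^sub>0)\<close>, \<open>y\<^sub>k(t\<^sub>1)\<close> determine \<open>a\<^sub>k\<close> and \<open>b\<^sub>k\<close>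
  through a linear system of determinant \<open>- 2 i sin(k\<tau>)\<close>. A loss of \<open>\<delta>\<close> derivatives
  is a loss of a factor \<open>k\<^sup>\<delta>\<close> on the mode \<open>k\<close>, so the pair is strategic exactly when
  \<open>\<bar>sin(k\<tau>)\<bar> \<ge> c k\<^sup>-\<^sup>\<delta>\<close> for all \<open>k \<ge> 1\<close> and some \<open>c > 0\<close>. Since \<open>\<bar>sin(\<pi>x)\<bar>\<close> is comparable with the distance of
  \<open>x\<close> to the nearest integer, this says that \<open>\<tau>/\<pi>\<close> cannot be approximated by rationals \<open>p/q\<close>
  better than \<open>c/q\<^sup>1\<^sup>+\<^sup>\<delta>\<close> (\<open>strategic_pairs_iff_diophantine\<close>). The rest is Diophantine approximation:

  \<^item> For \<open>\<delta> < 1\<close> Dirichlet's theorem excludes every real number (\<open>diophantine_empty\<close>).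

  \<^item> For \<open>\<delta> > 1\<close> the excluded numbers of a bounded interval lie, for every \<open>c\<close>, in neighbourhoods of
    the rationals of total length \<open>O(c \<Sum>q. q\<^sup>-\<^sup>\<delta>)\<close>, which tends to \<open>0\<close> with \<open>c\<close>
    (\<open>null_sets_compl_diophantine\<close>).

  \<^item> For \<open>\<delta> = 1\<close> the admissible numbers are the badly approximable ones. For fixed \<open>c\<close> they form a
    uniformly porous set: Dirichlet's theorem puts, at every scale around each of its points, a
    rational whose excluded neighbourhood is comparable with that scale. A porous set is a
    null set (\<open>null_sets_diophantine_const\<close>), and by Fubini so is the set of pairs with \<open>\<tau>/\<pi>\<close> in it.

  \<^item> That the dimension is nevertheless \<open>2\<close> is a planar form of Jarnik's theorem. Divide a square into \<open>R\<^sup>2\<close> equal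
    squares and keep those whose second coordinate avoids the neighbourhoods of the rationals with
    \<open>R\<^sup>n \<le> q\<^sup>2 < R\<^sup>n\<^sup>+\<^sup>1\<close>. Two such rationals are further apart than the side of a square of generation
    \<open>n\<close>, so only one of them matters and at most three of the \<open>R\<close> rows are lost. A set of small diameter meets at
    most nine of the remaining \<open>R(R - 3)\<close> squares; as \<open>9 R\<^sup>d \<le> R(R - 3)\<close> for \<open>d < 2\<close> and large \<open>R\<close>, a
    cover whose sum of \<open>d\<close>-th powers of diameters is small can be outrun: some subsquare meets
    so little of the cover that no member as large as the subsquare's own
    side can touch it, and the limit point of such a choice is badly approximable and
    uncovered (\<open>badly_approximable_uncovered\<close>). This gives the lower bound without
    constructing a measure on the Cantor set; the upper bound holds for every subset of the plane.
\<close>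

section \<open>Real numbers that are not well approximable\<close>

definition diophantine_const :: "real \<Rightarrow> real \<Rightarrow> real set" where
  "diophantine_const \<delta> c =
     {x. \<forall>q\<ge>1. \<forall>p::int. c * real q powr (- \<delta>) \<le> \<bar>real q * x - of_int p\<bar>}"

definition diophantine :: "real \<Rightarrow> real set" where
  "diophantine \<delta> = (\<Union>c\<in>{0<..}. diophantine_const \<delta> c)"

lemma diophantine_constD:
  "x \<in> diophantine_const \<delta> c \<Longrightarrow> 1 \<le> q \<Longrightarrow> c * real q powr (- \<delta>) \<le> \<bar>real q * x - of_int p\<bar>"
  by (simp add: diophantine_const_def)

lemma diophantine_const_antimono:
  assumes "c \<le> d" shows "diophantine_const \<delta> d \<subseteq> diophantine_const \<delta> c"
proof -
  have "c * real q powr (- \<delta>) \<le> d * real q powr (- \<delta>)" for q :: nat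
    using assms by (rule mult_right_mono) simp
  then show ?thesis unfolding diophantine_const_def by (blast intro: order_trans)
qed

lemma diophantine_eq_Union:
  "diophantine \<delta> = (\<Union>n. diophantine_const \<delta> (1 / real (Suc n)))"
proof
  show "diophantine \<delta> \<subseteq> (\<Union>n. diophantine_const \<delta> (1 / real (Suc n)))"
  proof
    fix x assume "x \<in> diophantine \<delta>"
    then obtain c where c: "c > 0" "x \<in> diophantine_const \<delta> c" by (auto simp: diophantine_def)
    obtain n where "1 / real (Suc n) < c" using c(1) nat_approx_posE by blast
    then have "x \<in> diophantine_const \<delta> (1 / real (Suc n))"
      using c(2) diophantine_const_antimono[of "1 / real (Suc n)" c \<delta>] by auto
    then show "x \<in> (\<Union>n. diophantine_const \<delta> (1 / real (Suc n)))" by blast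
  qed
  show "(\<Union>n. diophantine_const \<delta> (1 / real (Suc n))) \<subseteq> diophantine \<delta>"
    unfolding diophantine_def by (intro UN_mono UN_least UN_upper) simp
qed

lemma closed_diophantine_const: "closed (diophantine_const \<delta> c)"
  unfolding diophantine_const_def
  by (intro closed_Collect_all closed_Collect_imp open_Collect_const closed_Collect_le continuous_intros)

lemma borel_diophantine_const [measurable]: "diophantine_const \<delta> c \<in> sets borel"
  by (rule borel_closed[OF closed_diophantine_const])

lemma borel_diophantine [measurable]: "diophantine \<delta> \<in> sets borel"
  unfolding diophantine_eq_Union by measurable

lemma Dirichlet_approx_nat:
  fixes x :: real and N :: nat
  assumes "0 < N"
  obtains p :: int and q :: nat where "1 \<le> q" "q \<le> N" "\<bar>real q * x - of_int p\<bar> < 1 / N"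
proof -
  obtain h k where hk: "0 < k" "k \<le> int N" "\<bar>of_int k * x - of_int h\<bar> < 1 / N"
    using Dirichlet_approx[OF assms] by blast
  show thesis
    using hk by (intro that[of "nat k" h]) auto
qed

text \<open>
  By Dirichlet's theorem some \<open>q \<le> N\<close> has \<open>\<bar>qx - p\<bar> < 1/N\<close>, while membership
  forces \<open>\<bar>qx - p\<bar> \<ge> c N\<^sup>-\<^sup>\<delta>\<close>; so \<open>c \<le> N\<^sup>\<delta>\<^sup>-\<^sup>1\<close> for every \<open>N\<close>.
\<close>

lemma diophantine_empty:
  assumes "0 \<le> \<delta>" "\<delta> < 1"
  shows "diophantine \<delta> = {}"
proof (rule ccontr)
  assume "diophantine \<delta> \<noteq> {}"
  then obtain x c where c: "c > 0" and x: "x \<in> diophantine_const \<delta> c" by (auto simp: diophantine_def)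
  have "c \<le> real N powr (\<delta> - 1)" if N: "0 < N" for N
  proof -
    obtain p :: int and q :: nat where q: "1 \<le> q" "q \<le> N" and p: "\<bar>real q * x - of_int p\<bar> < 1 / N"
      using Dirichlet_approx_nat[OF N] by blast
    have "c * real N powr (- \<delta>) \<le> c * real q powr (- \<delta>)"
      using c q assms by (intro mult_left_mono powr_mono2') auto
    also have "\<dots> \<le> 1 / N" using diophantine_constD[OF x q(1), of p] p by linarith
    finally have "c * real N powr (- \<delta>) * real N powr \<delta> \<le> 1 / N * real N powr \<delta>"
      by (rule mult_right_mono) simp
    moreover have "c * real N powr (- \<delta>) * real N powr \<delta> = c"
      using N by (simp add: mult.assoc flip: powr_add)
    ultimately show ?thesis using N by (simp add: powr_diff)
  qed
  moreover have "(\<lambda>N. real N powr (\<delta> - 1)) \<longlonglongrightarrow> 0"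
    by (rule tendsto_neg_powr[OF _ filterlim_real_sequentially]) (use assms in auto)
  ultimately have "c \<le> 0"
    by (intro LIMSEQ_le_const[of "\<lambda>N. real N powr (\<delta> - 1)"]) (auto intro!: exI[of _ 1])
  then show False using c by simp
qed

section \<open>Strategic pairs are a Diophantine condition\<close>

lemma abs_sin_pi_diff_int: "\<bar>sin (pi * (x - of_int p))\<bar> = \<bar>sin (pi * x)\<bar>"
proof -
  have sin0: "sin (pi * of_int p) = 0" by (simp add: sin_times_pi_eq_0 mult.commute[of pi])
  then have "(cos (pi * of_int p))\<^sup>2 = 1" using sin_cos_squared_add[of "pi * of_int p"] by simp
  then have "\<bar>cos (pi * of_int p)\<bar> = 1" by (auto simp: power2_eq_1_iff)
  then show ?thesis by (simp add: right_diff_distrib sin_diff sin0 abs_mult)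
qed

lemma abs_sin_pi_le: "\<bar>sin (pi * x)\<bar> \<le> pi * \<bar>x - of_int p\<bar>"
proof -
  have "\<bar>sin (pi * (x - of_int p))\<bar> \<le> \<bar>pi * (x - of_int p)\<bar>" by (rule abs_sin_x_le_abs_x)
  then show ?thesis by (simp add: abs_sin_pi_diff_int abs_mult)
qed

text \<open>
  The optimal slope would be \<open>2/\<pi>\<close>; any positive one serves. It follows from \<open>y cos y \<le> sin y\<close> at
  \<open>y = x/2\<close>, the double-angle formula and \<open>cos\<^sup>2 y \<ge> 1/2\<close>.
\<close>

lemma half_le_sin:
  assumes x: "0 \<le> x" "x \<le> pi / 2"
  shows "x / 2 \<le> sin x"
proof -
  define y where "y = x / 2"
  have "sin 0 - 0 * cos 0 \<le> sin y - y * cos y"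
  proof (rule DERIV_nonneg_imp_nondecreasing[of 0 y "\<lambda>t. sin t - t * cos t"])
    show "0 \<le> y" using x by (simp add: y_def)
    fix t assume t: "0 \<le> t" "t \<le> y"
    then have "0 \<le> t * sin t" using x by (intro mult_nonneg_nonneg sin_ge_zero) (auto simp: y_def)
    moreover have "((\<lambda>t. sin t - t * cos t) has_real_derivative t * sin t) (at t)"
      by (auto intro!: derivative_eq_intros)
    ultimately show "\<exists>D. ((\<lambda>t. sin t - t * cos t) has_real_derivative D) (at t) \<and> 0 \<le> D" by blast
  qed
  then have "y * cos y \<le> sin y" by simp
  moreover have "0 \<le> cos y" using x by (intro cos_ge_zero) (auto simp: y_def)
  ultimately have "2 * (y * cos y) * cos y \<le> 2 * sin y * cos y" by (intro mult_right_mono) auto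
  also have "\<dots> = sin x" using sin_double[of y] by (simp add: y_def)
  finally have "x * (cos y)\<^sup>2 \<le> sin x" by (simp add: y_def power2_eq_square)
  moreover have "1 / 2 \<le> (cos y)\<^sup>2"
    using cos_double_cos[of y] cos_ge_zero[of x] x by (simp add: y_def)
  then have "x * (1 / 2) \<le> x * (cos y)\<^sup>2" using x by (intro mult_left_mono) auto
  ultimately show ?thesis by simp
qed

lemma dist_round_le_abs_sin_pi: "\<bar>x - of_int (round x)\<bar> \<le> \<bar>sin (pi * x)\<bar>"
proof -
  define u where "u = \<bar>x - of_int (round x)\<bar>"
  have u: "0 \<le> u" "u \<le> 1 / 2" using of_int_round_abs_le[of x] by (auto simp: u_def abs_minus_commute)
  have "pi * u \<le> pi / 2" using u by (simp add: field_simps)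
  then have "pi * u / 2 \<le> sin (pi * u)" using u by (intro half_le_sin) auto
  moreover have "2 * u \<le> pi * u" using u pi_ge_two by (intro mult_right_mono) auto
  ultimately have "u \<le> sin (pi * u)" by linarith
  also have "\<dots> = \<bar>sin (pi * (x - of_int (round x)))\<bar>"
  proof -
    define v where "v = x - of_int (round x)"
    have "u = v \<or> u = - v" by (auto simp: u_def v_def abs_if)
    then have "\<bar>sin (pi * u)\<bar> = \<bar>sin (pi * v)\<bar>" by (elim disjE) simp_all
    moreover have "0 \<le> sin (pi * u)" using \<open>u \<le> sin (pi * u)\<close> u by linarith
    ultimately show ?thesis by (simp add: v_def)
  qed
  also have "\<dots> = \<bar>sin (pi * x)\<bar>" by (rule abs_sin_pi_diff_int)
  finally show ?thesis unfolding u_def .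
qed

text \<open>
  Transfers a bound on each mode to the norms of the series.
\<close>

lemma sine_norm_le_of_coeff_le:
  assumes A: "A \<in> sine_space r" and B: "B \<in> sine_space r" and M: "0 \<le> M"
    and le: "\<And>k. 1 \<le> k \<Longrightarrow> real k powr s * cmod (c k) \<le> M * (real k powr r * (cmod (A k) + cmod (B k)))"
  shows "sine_norm s c \<le> 2 * M * (sine_norm r A + sine_norm r B)"
proof -
  have sq: "real k powr (2 * t) = (real k powr t)\<^sup>2" for k t
    by (simp add: power2_eq_square flip: powr_add)
  have term_le: "sine_term s c k \<le> (2 * M)\<^sup>2 * (sine_term r A k + sine_term r B k)" for k
  proof (cases "k = 0")
    case False
    have "sine_term s c k = (real k powr s * cmod (c k))\<^sup>2" by (simp add: sq power_mult_distrib)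
    also have "\<dots> \<le> (M * (real k powr r * (cmod (A k) + cmod (B k))))\<^sup>2"
      using False by (intro power_mono le) auto
    also have "\<dots> = M\<^sup>2 * real k powr (2 * r) * (cmod (A k) + cmod (B k))\<^sup>2"
      by (simp add: sq power_mult_distrib)
    also have "\<dots> \<le> M\<^sup>2 * real k powr (2 * r) * (4 * ((cmod (A k))\<^sup>2 + (cmod (B k))\<^sup>2))"
    proof (intro mult_left_mono)
      have "(cmod (A k) + cmod (B k))\<^sup>2 \<le> 2 * ((cmod (A k))\<^sup>2 + (cmod (B k))\<^sup>2)"
        using sum_squares_bound[of "cmod (A k)" "cmod (B k)"] by (simp add: power2_sum)
      then show "(cmod (A k) + cmod (B k))\<^sup>2 \<le> 4 * ((cmod (A k))\<^sup>2 + (cmod (B k))\<^sup>2)"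
        by (rule order_trans) simp
    qed auto
    finally show ?thesis by (simp add: algebra_simps)
  qed simp
  have sA: "summable (sine_term r A)" and sB: "summable (sine_term r B)" using A B by (auto simp: sine_space_def)
  have s: "summable (\<lambda>k. (2 * M)\<^sup>2 * (sine_term r A k + sine_term r B k))"
    by (intro summable_mult summable_add sA sB)
  have "suminf (sine_term s c) \<le> (\<Sum>k. (2 * M)\<^sup>2 * (sine_term r A k + sine_term r B k))"
    by (intro suminf_le term_le s summable_comparison_test'[OF s, of 0]) (use term_le in auto)
  also have "\<dots> = (2 * M)\<^sup>2 * (suminf (sine_term r A) + suminf (sine_term r B))"
    using suminf_mult[OF summable_add[OF sA sB]] suminf_add[OF sA sB] by simp
  finally have "sine_norm s c \<le> sqrt ((2 * M)\<^sup>2 * (suminf (sine_term r A) + suminf (sine_term r B)))"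
    unfolding sine_norm_def by (rule real_sqrt_le_mono)
  also have "\<dots> = 2 * M * sqrt (suminf (sine_term r A) + suminf (sine_term r B))"
    using M by (simp add: real_sqrt_mult)
  also have "\<dots> \<le> 2 * M * (sine_norm r A + sine_norm r B)"
    unfolding sine_norm_def using M
    by (intro mult_left_mono sqrt_add_le_add_sqrt suminf_nonneg sA sB) auto
  finally show ?thesis .
qed

text \<open>
  Eliminating \<open>b k\<close> (or \<open>a k\<close>) from the values at the two times leaves \<open>\<plusminus> 2 \<i> sin(k(t\<^sub>1 - t\<^sub>0))\<close> times
  a phase times the other amplitude.
\<close>

lemma wave_amplitude_le:
  assumes S: "0 < m" "m \<le> \<bar>sin (real k * (t1 - t0))\<bar>"
  shows "2 * m * cmod (a k) \<le> cmod (wave a b t0 k) + cmod (wave a b t1 k)"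
    and "2 * m * cmod (b k) \<le> cmod (wave a b t0 k) + cmod (wave a b t1 k)"
proof -
  let ?A = "wave a b t0 k" and ?B = "wave a b t1 k" and ?\<theta> = "real k * (t1 - t0)"
  have sin2: "cis \<theta> - cis (- \<theta>) = 2 * \<i> * of_real (sin \<theta>)" for \<theta>
    by (simp add: complex_eq_iff)
  have cc: "cis (real k * t0) * cis ?\<theta> = cis (real k * t1)"
    "cis (- (real k * t0)) * cis (- ?\<theta>) = cis (- (real k * t1))"
    by (simp_all add: cis_mult algebra_simps)
  have "?B - cis (- ?\<theta>) * ?A = a k * (cis (real k * t0) * (cis ?\<theta> - cis (- ?\<theta>)))"
    unfolding wave_def cc[symmetric] by (simp add: algebra_simps)
  then have 1: "cmod (?B - cis (- ?\<theta>) * ?A) = cmod (a k) * (2 * \<bar>sin ?\<theta>\<bar>)"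
    unfolding sin2 by (simp add: norm_mult)
  have "cis ?\<theta> * ?A - ?B = b k * (cis (- (real k * t0)) * (cis ?\<theta> - cis (- ?\<theta>)))"
    unfolding wave_def cc[symmetric] by (simp add: algebra_simps)
  then have 2: "cmod (cis ?\<theta> * ?A - ?B) = cmod (b k) * (2 * \<bar>sin ?\<theta>\<bar>)"
    unfolding sin2 by (simp add: norm_mult)
  have "cmod (?B - cis (- ?\<theta>) * ?A) \<le> cmod ?A + cmod ?B"
    using norm_triangle_ineq4[of ?B "cis (- ?\<theta>) * ?A"] by (simp add: norm_mult)
  moreover have "cmod (cis ?\<theta> * ?A - ?B) \<le> cmod ?A + cmod ?B"
    using norm_triangle_ineq4[of "cis ?\<theta> * ?A" ?B] by (simp add: norm_mult)
  moreover have "2 * m * cmod (a k) \<le> cmod (a k) * (2 * \<bar>sin ?\<theta>\<bar>)"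
    "2 * m * cmod (b k) \<le> cmod (b k) * (2 * \<bar>sin ?\<theta>\<bar>)"
    using S mult_left_mono[OF S(2), of "cmod (a k)"] mult_left_mono[OF S(2), of "cmod (b k)"]
    by (auto simp: mult.commute)
  ultimately show "2 * m * cmod (a k) \<le> cmod ?A + cmod ?B" "2 * m * cmod (b k) \<le> cmod ?A + cmod ?B"
    using 1 2 by linarith+
qed

lemma string_ab_sum: "string_a y0 y1 k + string_b y0 y1 k = y0 k"
  by (simp add: string_a_def string_b_def flip: add_divide_distrib)

lemma string_ab_diff:
  assumes "1 \<le> k" shows "\<i> * of_nat k * (string_a y0 y1 k - string_b y0 y1 k) = y1 k"
  using assms by (simp add: string_a_def string_b_def field_simps)

lemma strategic_if_sin_bounded_below:
  assumes m: "0 < m" and sin_ge: "\<And>k. 1 \<le> k \<Longrightarrow> m * real k powr (s - r) \<le> \<bar>sin (real k * (t1 - t0))\<bar>"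
  shows "(t0, t1) \<in> strategic_pairs r s"
proof -
  have "sine_norm s y0 + sine_norm (s - 1) y1 \<le> 4 / m * (sine_norm r (y t0) + sine_norm r (y t1))"
    if y0: "y0 \<in> sine_space r" and y1: "y1 \<in> sine_space (r - 1)" and sol: "string_solution r y0 y1 y" for y0 y1 y
  proof -
    define a b where "a = string_a y0 y1" and "b = string_b y0 y1"
    have y: "y = wave a b" using sol string_solution_iff[OF y0 y1] by (simp add: a_def b_def)
    have mem: "y t \<in> sine_space r" for t
      using sol unfolding string_solution_def sine_continuous_def by blast
    let ?N = "\<lambda>k. cmod (y t0 k) + cmod (y t1 k)"
    have ab: "real k powr s * (cmod (a k) + cmod (b k)) \<le> 1 / m * (real k powr r * ?N k)" if k: "1 \<le> k" for k
    proof -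
      have "0 < m * real k powr (s - r)" using m k by simp
      from wave_amplitude_le(1)[OF this sin_ge[OF k], of a b] wave_amplitude_le(2)[OF this sin_ge[OF k], of b a]
      have "m * real k powr (s - r) * (cmod (a k) + cmod (b k)) \<le> ?N k"
        unfolding y[symmetric] by (simp add: algebra_simps)
      then have "real k powr r * (m * real k powr (s - r) * (cmod (a k) + cmod (b k))) \<le> real k powr r * ?N k"
        by (rule mult_left_mono) simp
      moreover have "real k powr s = real k powr r * real k powr (s - r)" by (simp flip: powr_add)
      then have "m * (real k powr s * (cmod (a k) + cmod (b k)))
          = real k powr r * (m * real k powr (s - r) * (cmod (a k) + cmod (b k)))" by (simp only: mult_ac)
      ultimately have "m * (real k powr s * (cmod (a k) + cmod (b k))) \<le> real k powr r * ?N k"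
        by (simp only:)
      then show ?thesis using m by (simp add: field_simps)
    qed
    have "sine_norm s y0 \<le> 2 * (1 / m) * (sine_norm r (y t0) + sine_norm r (y t1))"
    proof (rule sine_norm_le_of_coeff_le[OF mem mem])
      fix k :: nat assume k: "1 \<le> k"
      have "cmod (y0 k) \<le> cmod (a k) + cmod (b k)"
        unfolding string_ab_sum[of y0 y1 k, symmetric] a_def b_def by (rule norm_triangle_ineq)
      then have "real k powr s * cmod (y0 k) \<le> real k powr s * (cmod (a k) + cmod (b k))"
        by (rule mult_left_mono) simp
      with ab[OF k] show "real k powr s * cmod (y0 k) \<le> 1 / m * (real k powr r * ?N k)" by linarith
    qed (use m in simp)
    moreover have "sine_norm (s - 1) y1 \<le> 2 * (1 / m) * (sine_norm r (y t0) + sine_norm r (y t1))"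
    proof (rule sine_norm_le_of_coeff_le[OF mem mem])
      fix k :: nat assume k: "1 \<le> k"
      have "cmod (y1 k) = real k * cmod (a k - b k)"
        unfolding string_ab_diff[OF k, of y0 y1, symmetric] a_def b_def by (simp add: norm_mult)
      also have "\<dots> \<le> real k * (cmod (a k) + cmod (b k))"
        by (intro mult_left_mono norm_triangle_ineq4) simp
      finally have "real k powr (s - 1) * cmod (y1 k) \<le> real k powr (s - 1) * (real k * (cmod (a k) + cmod (b k)))"
        by (rule mult_left_mono) simp
      also have "\<dots> = real k powr s * (cmod (a k) + cmod (b k))"
        using k by (simp add: powr_diff)
      finally show "real k powr (s - 1) * cmod (y1 k) \<le> 1 / m * (real k powr r * ?N k)"
        using ab[OF k] by linarith
    qed (use m in simp)
    ultimately have "sine_norm s y0 + sine_norm (s - 1) y1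
        \<le> 2 * (1 / m) * (sine_norm r (y t0) + sine_norm r (y t1)) + 2 * (1 / m) * (sine_norm r (y t0) + sine_norm r (y t1))"
      by (rule add_mono)
    also have "\<dots> = 4 / m * (sine_norm r (y t0) + sine_norm r (y t1))"
      using m by (simp add: field_simps)
    finally show ?thesis .
  qed
  then show ?thesis using m unfolding strategic_pairs_def by (auto intro!: exI[of _ "4 / m"])
qed

lemma single_mode:
  fixes k :: nat and z :: complex
  assumes "1 \<le> k"
  shows "(\<lambda>j. if j = k then z else 0) \<in> sine_space s"
    and "sine_norm s (\<lambda>j. if j = k then z else 0) = real k powr s * cmod z"
proof -
  have eq: "sine_term s (\<lambda>j. if j = k then z else 0) = (\<lambda>j. if j = k then (real k powr s * cmod z)\<^sup>2 else 0)"
  proof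
    fix j
    have "real k powr (2 * s) = (real k powr s)\<^sup>2" by (simp add: power2_eq_square flip: powr_add)
    then show "sine_term s (\<lambda>j. if j = k then z else 0) j = (if j = k then (real k powr s * cmod z)\<^sup>2 else 0)"
      by (simp add: power_mult_distrib)
  qed
  show "(\<lambda>j. if j = k then z else 0) \<in> sine_space s"
    using assms unfolding sine_space_def mem_Collect_eq eq by (auto intro!: summable_finite[of "{k}"])
  show "sine_norm s (\<lambda>j. if j = k then z else 0) = real k powr s * cmod z"
    
    unfolding sine_norm_def eq sums_unique[OF sums_single[of k "\<lambda>_. (real k powr s * cmod z)\<^sup>2"], symmetric] by simp
qed

text \<open>
  The test solution is the single mode \<open>sin(k(t - t\<^sub>0)) sin(kx)\<close>. It vanishes at \<open>t\<^sub>0\<close>, so the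
  inequality of a strategic pair compares its initial norm, of order \<open>k\<^sup>s\<close>, with \<open>k\<^sup>r \<bar>sin(k(t\<^sub>1 - t\<^sub>0))\<bar>\<close>.
\<close>

lemma sin_bounded_below_if_strategic:
  assumes "(t0, t1) \<in> strategic_pairs r s"
  shows "\<exists>m>0. \<forall>k\<ge>1. m * real k powr (s - r) \<le> \<bar>sin (real k * (t1 - t0))\<bar>"
proof -
  obtain c where c: "c > 0" and ineq: "\<And>y0 y1 y. y0 \<in> sine_space r \<Longrightarrow> y1 \<in> sine_space (r - 1) \<Longrightarrow>
      string_solution r y0 y1 y \<Longrightarrow>
      sine_norm s y0 + sine_norm (s - 1) y1 \<le> c * (sine_norm r (y t0) + sine_norm r (y t1))"
    using assms unfolding strategic_pairs_def by auto
  have "1 / c * real k powr (s - r) \<le> \<bar>sin (real k * (t1 - t0))\<bar>" if k: "1 \<le> k" for k :: nat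
  proof -
    let ?m = "\<lambda>z j. if j = k then z else (0::complex)"
    define y0 where "y0 = ?m (complex_of_real (- sin (real k * t0)))"
    define y1 where "y1 = ?m (complex_of_real (real k * cos (real k * t0)))"
    define y where "y = wave (string_a y0 y1) (string_b y0 y1)"
    have y: "y t = ?m (complex_of_real (sin (real k * (t - t0))))" for t
    proof
      fix j
      show "y t j = ?m (complex_of_real (sin (real k * (t - t0)))) j"
      proof (cases "j = k")
        case True
        then show ?thesis using k
          by (simp add: y_def wave_def string_a_def string_b_def y0_def y1_def complex_eq_iff
              Re_divide Im_divide sin_diff right_diff_distrib field_simps power2_eq_square)
      qed (simp add: y_def wave_def string_a_def string_b_def y0_def y1_def)
    qed
    have mem: "y0 \<in> sine_space r" "y1 \<in> sine_space (r - 1)"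
      unfolding y0_def y1_def by (intro single_mode k)+
    have "sine_norm s y0 + sine_norm (s - 1) y1 \<le> c * (sine_norm r (y t0) + sine_norm r (y t1))"
      using ineq[OF mem] string_solution_iff[OF mem] unfolding y_def by blast
    moreover have "sine_norm s y0 = real k powr s * \<bar>sin (real k * t0)\<bar>"
      unfolding y0_def single_mode(2)[OF k] norm_of_real by simp
    moreover have "sine_norm (s - 1) y1 = real k powr s * \<bar>cos (real k * t0)\<bar>"
      unfolding y1_def single_mode(2)[OF k] norm_of_real using k by (simp add: abs_mult powr_diff)
    moreover have "sine_norm r (y t) = real k powr r * \<bar>sin (real k * (t - t0))\<bar>" for t
      unfolding y single_mode(2)[OF k] norm_of_real by simp
    ultimately have "real k powr s * (\<bar>sin (real k * t0)\<bar> + \<bar>cos (real k * t0)\<bar>) \<le> c * (real k powr r * \<bar>sin (real k * (t1 - t0))\<bar>)"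
      by (simp add: distrib_left)
    moreover have "1 \<le> \<bar>sin x\<bar> + \<bar>cos x\<bar>" for x :: real
    proof -
      have "\<bar>sin x\<bar>\<^sup>2 + \<bar>cos x\<bar>\<^sup>2 = 1" by simp
      moreover have "\<bar>sin x\<bar>\<^sup>2 \<le> \<bar>sin x\<bar>" "\<bar>cos x\<bar>\<^sup>2 \<le> \<bar>cos x\<bar>"
        unfolding power2_eq_square by (intro mult_left_le abs_sin_le_one abs_cos_le_one abs_ge_zero)+
      ultimately show ?thesis by linarith
    qed
    then have "real k powr s * 1 \<le> real k powr s * (\<bar>sin (real k * t0)\<bar> + \<bar>cos (real k * t0)\<bar>)"
      by (intro mult_left_mono) auto
    ultimately have "real k powr s \<le> c * (real k powr r * \<bar>sin (real k * (t1 - t0))\<bar>)" by linarith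
    moreover have "real k powr s = real k powr r * real k powr (s - r)" by (simp flip: powr_add)
    ultimately have "real k powr r * real k powr (s - r) \<le> real k powr r * (c * \<bar>sin (real k * (t1 - t0))\<bar>)"
      by (simp only: mult.left_commute)
    then have "real k powr (s - r) \<le> c * \<bar>sin (real k * (t1 - t0))\<bar>" using k by simp
    then show ?thesis using c by (simp add: divide_le_eq mult.commute)
  qed
  then show ?thesis using c by (intro exI[of _ "1 / c"]) auto
qed

theorem strategic_pairs_iff_diophantine:
  "(t0, t1) \<in> strategic_pairs r s \<longleftrightarrow> (t1 - t0) / pi \<in> diophantine (r - s)"
proof -
  define x where "x = (t1 - t0) / pi"
  have sin_eq: "sin (real k * (t1 - t0)) = sin (pi * (real k * x))" for k
    by (simp add: x_def)
  show ?thesis unfolding x_def[symmetric]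
  proof
    assume "(t0, t1) \<in> strategic_pairs r s"
    then obtain m where m: "m > 0" "\<And>k. 1 \<le> k \<Longrightarrow> m * real k powr (s - r) \<le> \<bar>sin (real k * (t1 - t0))\<bar>"
      using sin_bounded_below_if_strategic by blast
    have "m / pi * real k powr (- (r - s)) \<le> \<bar>real k * x - of_int p\<bar>" if "1 \<le> k" for k :: nat and p :: int
    proof -
      have "m * real k powr (- (r - s)) \<le> pi * \<bar>real k * x - of_int p\<bar>"
        using order_trans[OF m(2)[OF that, unfolded sin_eq] abs_sin_pi_le[of "real k * x" p]] by simp
      then show ?thesis by (simp add: pos_divide_le_eq mult.commute)
    qed
    then have "x \<in> diophantine_const (r - s) (m / pi)" by (simp add: diophantine_const_def)
    then show "x \<in> diophantine (r - s)" using m(1) unfolding diophantine_def by (intro UN_I[of "m / pi"]) auto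
  next
    assume "x \<in> diophantine (r - s)"
    then obtain c where c: "c > 0" "x \<in> diophantine_const (r - s) c" by (auto simp: diophantine_def)
    show "(t0, t1) \<in> strategic_pairs r s"
    proof (rule strategic_if_sin_bounded_below[OF c(1)])
      fix k :: nat assume k: "1 \<le> k"
      show "c * real k powr (s - r) \<le> \<bar>sin (real k * (t1 - t0))\<bar>"
        using order_trans[OF diophantine_constD[OF c(2) k] dist_round_le_abs_sin_pi[of "real k * x"]]
        unfolding sin_eq by simp
    qed
  qed
qed

section \<open>Almost every number satisfies a Diophantine condition of exponent above one\<close>

text \<open>
  A union bound for fixed \<open>c\<close> suffices: the resulting estimate is linear in \<open>c\<close>, and the complement is
  contained in the exceptional set of every \<open>c\<close>.
\<close>

lemma null_sets_compl_diophantine: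
  assumes \<delta>: "1 < \<delta>"
  shows "- diophantine \<delta> \<in> null_sets lborel"
proof -
  define S where "S = (\<Sum>q. real (Suc q) powr (- \<delta>))"
  have sm: "summable (\<lambda>q. real (Suc q) powr (- \<delta>))"
    using \<delta> summable_Suc_iff[of "\<lambda>q. real q powr (- \<delta>)"] summable_real_powr_iff[of "- \<delta>"] by simp
  have S: "0 \<le> S" unfolding S_def by (intro suminf_nonneg sm) auto
  have cover: "emeasure lborel ({- real M..real M} - diophantine \<delta>) \<le> ennreal (10 * M * S * c)"
    if c: "0 < c" "c \<le> 1" and M: "M \<ge> 1" for c :: real and M :: nat
  proof -
    define r where "r q = c * real (Suc q) powr (- \<delta>) / real (Suc q)" for q
    define P where "P q = {- (int M * int (Suc q) + 1)..int M * int (Suc q) + 1}" for q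
    define B where "B q = (\<Union>p\<in>P q. ball (of_int p / real (Suc q)) (r q))" for q
    have r: "r q > 0" for q using c by (simp add: r_def)
    have sub: "{- real M..real M} - diophantine \<delta> \<subseteq> (\<Union>q. B q)"
    proof
      fix x assume x: "x \<in> {- real M..real M} - diophantine \<delta>"
      then have "x \<notin> diophantine_const \<delta> c" using c by (auto simp: diophantine_def)
      then obtain q0 :: nat and p :: int where "q0 \<ge> 1" "\<bar>real q0 * x - of_int p\<bar> < c * real q0 powr (- \<delta>)"
        by (auto simp: diophantine_const_def not_le)
      then obtain q where p: "\<bar>real (Suc q) * x - of_int p\<bar> < c * real (Suc q) powr (- \<delta>)"
        by (metis Suc_le_D One_nat_def)
      have "real (Suc q) powr (- \<delta>) \<le> 1" using \<delta> powr_mono[of "- \<delta>" 0 "real (Suc q)"] by simp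
      then have "c * real (Suc q) powr (- \<delta>) \<le> 1" using c by (intro mult_le_one) auto
      moreover have "\<bar>real (Suc q) * x\<bar> \<le> real M * real (Suc q)"
        using x by (auto simp: abs_mult mult.commute intro!: mult_right_mono)
      ultimately have "\<bar>real_of_int p\<bar> \<le> real M * real (Suc q) + 1" using p by linarith
      then have "\<bar>real_of_int p\<bar> \<le> of_int (int M * int (Suc q) + 1)" by simp
      then have "p \<in> P q" unfolding P_def by (simp only: atLeastAtMost_iff of_int_abs[symmetric] of_int_le_iff) linarith
      moreover have "\<bar>x - of_int p / real (Suc q)\<bar> < r q"
      proof -
        have "x - of_int p / real (Suc q) = (real (Suc q) * x - of_int p) / real (Suc q)"
          by (simp add: field_simps)
        then show ?thesis using p unfolding r_def by (simp add: divide_strict_right_mono del: of_nat_Suc)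
      qed
      ultimately show "x \<in> (\<Union>q. B q)" by (auto simp: B_def dist_real_def abs_minus_commute)
    qed
    \<comment> \<open>At most \<open>2Mq' + 3 \<le> 5Mq'\<close> intervals of length \<open>2 c q'\<^sup>-\<^sup>\<delta> / q'\<close>, where \<open>q' = Suc q\<close>.\<close>
    have B: "emeasure lborel (B q) \<le> ennreal (10 * M * c * real (Suc q) powr (- \<delta>))" for q
    proof -
      have "emeasure lborel (B q) \<le> (\<Sum>p\<in>P q. emeasure lborel (ball (of_int p / real (Suc q)) (r q)))"
        unfolding B_def by (rule emeasure_subadditive_finite) (auto simp: P_def)
      also have "\<dots> = (\<Sum>p\<in>P q. ennreal (2 * r q))"
        using r[of q] by (intro sum.cong) (simp_all add: ball_eq_greaterThanLessThan)
      also have "\<dots> = ennreal (real (card (P q)) * (2 * r q))"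
        using r[of q] by (simp add: ennreal_mult' ennreal_of_nat_eq_real_of_nat)
      also have "\<dots> \<le> ennreal (real (5 * M * Suc q) * (2 * r q))"
      proof (intro ennreal_leI mult_right_mono)
        have "card (P q) = 2 * (M * Suc q) + 3" by (simp add: P_def nat_add_distrib nat_mult_distrib algebra_simps)
        moreover have "1 \<le> M * Suc q" using M by simp
        ultimately have "card (P q) \<le> 5 * M * Suc q" by linarith
        then show "real (card (P q)) \<le> real (5 * M * Suc q)" by (metis of_nat_le_iff)
      qed (use r[of q] in simp)
      also have "real (5 * M * Suc q) * (2 * r q) = 10 * M * c * real (Suc q) powr (- \<delta>)"
      proof -
        have "5 * m * n * (2 * (c * z / n)) = 10 * m * c * z" if "n > 0" for m n z :: real
          using that by simp
        then show ?thesis 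
          unfolding r_def of_nat_mult of_nat_numeral by (simp del: of_nat_Suc)
      qed
      finally show ?thesis .
    qed
    have "emeasure lborel ({- real M..real M} - diophantine \<delta>) \<le> emeasure lborel (\<Union>q. B q)"
      by (intro emeasure_mono sub) (auto simp: B_def)
    also have "\<dots> \<le> (\<Sum>q. emeasure lborel (B q))"
      by (rule emeasure_subadditive_countably) (auto simp: B_def)
    also have "\<dots> \<le> (\<Sum>q. ennreal (10 * M * c * real (Suc q) powr (- \<delta>)))"
      by (intro suminf_le B) auto
    also have "\<dots> = ennreal (\<Sum>q. 10 * M * c * real (Suc q) powr (- \<delta>))"
      using c by (intro suminf_ennreal2 summable_mult sm) auto
    also have "(\<Sum>q. 10 * M * c * real (Suc q) powr (- \<delta>)) = 10 * M * S * c"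
      using suminf_mult[OF sm, of "10 * M * c"] by (simp add: S_def mult_ac)
    finally show ?thesis .
  qed
  have "{- real (Suc M)..real (Suc M)} - diophantine \<delta> \<in> null_sets lborel" for M
  proof (rule null_setsI)
    have "emeasure lborel ({- real (Suc M)..real (Suc M)} - diophantine \<delta>) \<le> 0 + ennreal e" if e: "e > 0" for e
    proof -
      define K where "K = 10 * real (Suc M) * S"
      have K: "K \<ge> 0" using S by (simp add: K_def)
      define c where "c = min 1 (e / (K + 1))"
      have c: "0 < c" "c \<le> 1" using e K by (auto simp: c_def)
      have "K * c \<le> (K + 1) * (e / (K + 1))" using K e by (intro mult_mono) (auto simp: c_def)
      also have "\<dots> = e" using K by simp
      finally have le: "ennreal (real (10 * Suc M) * S * c) \<le> ennreal e"
        unfolding K_def by (intro ennreal_leI) (simp only: of_nat_mult of_nat_numeral)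
      have "1 \<le> Suc M" by simp
      from cover[OF c this] le show ?thesis unfolding add_0 by (rule order_trans)
    qed
    then show "emeasure lborel ({- real (Suc M)..real (Suc M)} - diophantine \<delta>) = 0"
      by (meson ennreal_le_epsilon le_zero_eq)
  qed simp
  then have "(\<Union>M. {- real (Suc M)..real (Suc M)} - diophantine \<delta>) \<in> null_sets lborel" by blast
  moreover have "- diophantine \<delta> = (\<Union>M. {- real (Suc M)..real (Suc M)} - diophantine \<delta>)"
  proof -
    have "\<exists>M. x \<in> {- real (Suc M)..real (Suc M)}" for x :: real
    proof -
      obtain n where "\<bar>x\<bar> \<le> real n" using real_arch_simple by blast
      then show ?thesis by (intro exI[of _ n]) auto
    qed
    then show ?thesis by blast
  qed
  ultimately show ?thesis by simp
qed

section \<open>Badly approximable numbers form a null set\<close>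

text \<open>
  The hole is centred at a Dirichlet approximation \<open>p/q\<close> of \<open>x\<close> with \<open>q \<le> N\<close>, where \<open>N\<^sup>2\<close> is of order
  \<open>1/(c\<rho>)\<close>. Because \<open>x\<close> itself is badly approximable, \<open>q > cN\<close>, so \<open>p/q\<close> is within \<open>\<rho>/2\<close> of \<open>x\<close>;
  because \<open>q \<le> N\<close>, the interval of radius \<open>c/q\<^sup>2\<close> excluded around \<open>p/q\<close> is of length comparable with \<open>\<rho>\<close>.
\<close>

lemma diophantine_porous:
  fixes x :: real
  assumes x: "x \<in> diophantine_const 1 c" and c: "0 < c" "c \<le> 1" and \<rho>: "0 < \<rho>" "\<rho> \<le> 1"
  obtains y where "ball y (c\<^sup>2 * \<rho> / 8) \<subseteq> ball x \<rho>" "ball y (c\<^sup>2 * \<rho> / 8) \<inter> diophantine_const 1 c = {}"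
proof -
  define z where "z = sqrt (2 / (c * \<rho>))"
  define N where "N = nat \<lceil>z\<rceil>"
  have "c * \<rho> \<le> 1" using c \<rho> by (intro mult_le_one) auto
  then have z2: "z\<^sup>2 = 2 / (c * \<rho>)" "1 \<le> z" using c \<rho> by (simp_all add: z_def field_simps)
  then have N: "z \<le> real N" "real N \<le> 2 * z" "0 < N" unfolding N_def by linarith+
  have "z\<^sup>2 \<le> (real N)\<^sup>2" "(real N)\<^sup>2 \<le> 4 * z\<^sup>2"
    using power_mono[OF N(1), of 2] power_mono[OF N(2), of 2] z2(2) by (simp_all add: power_mult_distrib)
  then have N2: "2 / (c * \<rho>) \<le> (real N)\<^sup>2" "(real N)\<^sup>2 \<le> 8 / (c * \<rho>)"
    unfolding z2(1) by simp_all
  obtain p :: int and q :: nat where q: "1 \<le> q" "q \<le> N" and p: "\<bar>real q * x - of_int p\<bar> < 1 / N"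
    using Dirichlet_approx_nat[OF N(3)] by blast
  define y where "y = of_int p / real q"
  have "c / q < 1 / N"
    using diophantine_constD[OF x q(1), of p] p by (simp add: powr_minus_divide)
  then have cq: "c * real N < real q" using q N by (simp add: field_simps)
  have "\<bar>y - x\<bar> = \<bar>real q * x - of_int p\<bar> / q"
    using q by (simp add: y_def field_simps abs_if)
  also have "\<dots> < 1 / N / q" using p q by (intro divide_strict_right_mono) auto
  also have "\<dots> \<le> 1 / N / (c * N)" using cq c N q by (intro divide_left_mono mult_pos_pos) auto
  also have "\<dots> = 1 / (c * (real N)\<^sup>2)" by (simp add: power2_eq_square)
  also have "\<dots> \<le> 1 / (c * (2 / (c * \<rho>)))"
    using N2 c \<rho> N by (intro divide_left_mono mult_left_mono) auto
  also have "\<dots> = \<rho> / 2" using c by simp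
  finally have yx: "\<bar>y - x\<bar> < \<rho> / 2" .
  have "c\<^sup>2 * \<rho> \<le> \<rho>" using c \<rho> by (simp add: power_le_one)
  then have sub: "ball y (c\<^sup>2 * \<rho> / 8) \<subseteq> ball x \<rho>"
  proof (intro subsetI)
    fix u assume "u \<in> ball y (c\<^sup>2 * \<rho> / 8)"
    then have "\<bar>y - u\<bar> < c\<^sup>2 * \<rho> / 8" by (simp only: mem_ball dist_real_def)
    then show "u \<in> ball x \<rho>"
      using yx \<rho> \<open>c\<^sup>2 * \<rho> \<le> \<rho>\<close> by (simp only: mem_ball dist_real_def)
  qed
  have r: "c\<^sup>2 * \<rho> / 8 \<le> c / (real q)\<^sup>2"
  proof -
    have "(real q)\<^sup>2 \<le> (real N)\<^sup>2" using q by (intro power_mono) auto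
    then have "(real q)\<^sup>2 \<le> 8 / (c * \<rho>)" using N2 by linarith
    then show ?thesis using c \<rho> q by (simp add: field_simps power2_eq_square)
  qed
  have "u \<notin> diophantine_const 1 c" if u: "u \<in> ball y (c\<^sup>2 * \<rho> / 8)" for u
  proof
    assume "u \<in> diophantine_const 1 c"
    then have "c / q \<le> \<bar>real q * u - of_int p\<bar>"
      using diophantine_constD[OF _ q(1), of u 1 c p] by (simp add: powr_minus_divide)
    moreover have "\<bar>real q * u - of_int p\<bar> = real q * \<bar>u - y\<bar>"
      using q by (simp add: y_def abs_mult_pos' right_diff_distrib)
    moreover have "real q * \<bar>u - y\<bar> < real q * (c / (real q)\<^sup>2)"
      using u r q by (intro mult_strict_left_mono) (auto simp: less_le_trans dist_real_def abs_minus_commute simp del: less_divide_eq_numeral1 divide_le_eq_numeral1)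
    ultimately show False using q by (simp add: power2_eq_square)
  qed
  with sub that show thesis by blast
qed

lemma interval_partition:
  fixes a h :: real
  assumes h: "0 < h"
  shows "{a..<a + real R * h} = (\<Union>j<R. {a + real j * h..<a + real j * h + h})"
proof (induction R)
  case (Suc R)
  have "{a..<a + real (Suc R) * h} = {a..<a + real R * h} \<union> {a + real R * h..<a + real R * h + h}"
    using h by (subst ivl_disj_un(17)) (auto simp: algebra_simps)
  then show ?case using Suc by (simp add: lessThan_Suc Un_commute)
qed simp

text \<open>
  Either the middle third of the interval contains a point of the set, and porosity at scale \<open>L/3\<close>
  applies to it, or the middle third itself is the hole.
\<close>

lemma diophantine_hole:
  assumes c: "0 < c" "c \<le> 1" and L: "0 < L" "L \<le> 1"
  shows "\<exists>y\<in>{a<..<a + L}. ball y (c\<^sup>2 * L / 24) \<inter> diophantine_const 1 c = {}"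
proof (cases "\<exists>x\<in>diophantine_const 1 c. x \<in> {a + L/3..a + 2 * L/3}")
  case True
  then obtain x where x: "x \<in> diophantine_const 1 c" "x \<in> {a + L/3..a + 2 * L/3}" by blast
  obtain y where y: "ball y (c\<^sup>2 * (L/3) / 8) \<subseteq> ball x (L/3)"
      "ball y (c\<^sup>2 * (L/3) / 8) \<inter> diophantine_const 1 c = {}"
    using diophantine_porous[OF x(1) c, of "L/3"] L by auto
  have "y \<in> ball y (c\<^sup>2 * (L/3) / 8)" using c L by simp
  then have "y \<in> ball x (L/3)" using y(1) by blast
  then have "y \<in> {a<..<a + L}" using x(2) by (simp add: dist_real_def) argo
  then show ?thesis using y(2) by (auto intro!: bexI[of _ y])
next
  case False
  have "c\<^sup>2 * L \<le> L" using c L by (simp add: power_le_one)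
  then have "ball (a + L/2) (c\<^sup>2 * L / 24) \<subseteq> {a + L/3..a + 2 * L/3}"
  proof (intro subsetI)
    fix u assume "u \<in> ball (a + L/2) (c\<^sup>2 * L / 24)"
    then have "\<bar>a + L/2 - u\<bar> < c\<^sup>2 * L / 24" by (simp only: mem_ball dist_real_def)
    then show "u \<in> {a + L/3..a + 2 * L/3}" using \<open>c\<^sup>2 * L \<le> L\<close> L by (simp only: atLeastAtMost_iff) linarith
  qed
  then have "ball (a + L/2) (c\<^sup>2 * L / 24) \<inter> diophantine_const 1 c = {}" using False by blast
  then show ?thesis using L by (intro bexI[of _ "a + L/2"]) auto
qed

text \<open>
  When the interval is divided into \<open>R\<close> equal parts, one of them lies in a hole. The induction hypothesis applied to the
  other \<open>R - 1\<close> parts yields the factor \<open>(R - 1)/R\<close>.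
\<close>

lemma diophantine_const_interval_measure:
  assumes c: "0 < c" "c \<le> 1" and R: "0 < R" "24 < c\<^sup>2 * real R" and L: "0 < L" "L \<le> 1"
  shows "emeasure lborel (diophantine_const 1 c \<inter> {a..<a + L}) \<le> ennreal (((real R - 1) / real R) ^ n * L)"
  using L
proof (induction n arbitrary: a L)
  case 0
  have "emeasure lborel (diophantine_const 1 c \<inter> {a..<a + L}) \<le> emeasure lborel {a..<a + L}"
    by (intro emeasure_mono) auto
  then show ?case using 0 by simp
next
  case (Suc n)
  define h where "h = L / real R"
  have h: "0 < h" "h \<le> 1" "real R * h = L" using Suc.prems R by (simp_all add: h_def field_simps)
  let ?I = "\<lambda>j. {a + real j * h..<a + real j * h + h}"
  let ?D = "diophantine_const 1 c"
  obtain y where y: "y \<in> {a<..<a + L}" "ball y (c\<^sup>2 * L / 24) \<inter> ?D = {}"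
    using diophantine_hole[OF c Suc.prems] by blast
  have part: "{a..<a + L} = (\<Union>j<R. ?I j)" using interval_partition[OF h(1), of a R] h(3) by simp
  have "y \<in> {a..<a + L}" using y(1) by simp
  then obtain k where k: "k < R" "y \<in> ?I k" unfolding part by blast
  have "24 * L < c\<^sup>2 * real R * L" using R Suc.prems by simp
  then have "h < c\<^sup>2 * L / 24" using R by (simp add: h_def field_simps)
  then have "?I k \<subseteq> ball y (c\<^sup>2 * L / 24)" 
  proof (intro subsetI)
    fix u assume "u \<in> ?I k"
    then have "\<bar>y - u\<bar> < h" using k(2) by (simp only: atLeastLessThan_iff) linarith
    then show "u \<in> ball y (c\<^sup>2 * L / 24)"
      using \<open>h < c\<^sup>2 * L / 24\<close> by (simp only: mem_ball dist_real_def)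
  qed
  then have empty: "?D \<inter> ?I k = {}" using y(2) by blast
  have "?D \<inter> {a..<a + L} = (\<Union>j\<in>{..<R} - {k}. ?D \<inter> ?I j)" unfolding part using empty by blast
  also have "emeasure lborel \<dots> \<le> (\<Sum>j\<in>{..<R} - {k}. emeasure lborel (?D \<inter> ?I j))"
    by (rule emeasure_subadditive_finite) auto
  also have "\<dots> \<le> (\<Sum>j\<in>{..<R} - {k}. ennreal (((real R - 1) / real R) ^ n * h))"
    by (intro sum_mono Suc.IH h)
  also have "\<dots> = ennreal ((real R - 1) * (((real R - 1) / real R) ^ n * h))"
  proof -
    have "card ({..<R} - {k}) = R - 1" using k by simp
    moreover have "real (R - 1) = real R - 1" using R by (simp add: of_nat_diff)
    ultimately show ?thesis
      using R by (simp only: sum_constant ennreal_of_nat_eq_real_of_nat) (subst ennreal_mult', auto)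
  qed
  also have "(real R - 1) * (((real R - 1) / real R) ^ n * h) = ((real R - 1) / real R) ^ Suc n * L"
    by (simp add: h_def)
  finally show ?case .
qed

lemma null_sets_diophantine_const:
  assumes c: "0 < c" "c \<le> 1"
  shows "diophantine_const 1 c \<in> null_sets lborel"
proof -
  obtain R :: nat where "24 / c\<^sup>2 < real R" using reals_Archimedean2 by blast
  then have R': "24 < c\<^sup>2 * real R" using c by (simp add: field_simps)
  then have R: "0 < R" by (cases "R = 0") simp_all
  have lim: "(\<lambda>n. ((real R - 1) / real R) ^ n) \<longlonglongrightarrow> 0"
  proof (rule LIMSEQ_power_zero)
    have "0 \<le> (real R - 1) / real R" "(real R - 1) / real R < 1" using R by simp_all
    then show "norm ((real R - 1) / real R) < 1" by (simp only: real_norm_def abs_of_nonneg)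
  qed
  have "diophantine_const 1 c \<inter> {real_of_int m..<real_of_int m + 1} \<in> null_sets lborel" for m
  proof (rule null_setsI)
    have "(\<lambda>n. ennreal (((real R - 1) / real R) ^ n)) \<longlonglongrightarrow> 0"
      using tendsto_ennrealI[OF lim] by simp
    then show "emeasure lborel (diophantine_const 1 c \<inter> {real_of_int m..<real_of_int m + 1}) = 0"
      using LIMSEQ_le_const[of _ 0 "emeasure lborel (diophantine_const 1 c \<inter> {real_of_int m..<real_of_int m + 1})"]
        diophantine_const_interval_measure[OF c R R', of 1 "of_int m"] by (simp add: le_zero_eq)
  qed simp
  then have "(\<Union>m. diophantine_const 1 c \<inter> {real_of_int m..<real_of_int m + 1}) \<in> null_sets lborel"
    by (rule null_sets_UN)
  moreover have eq: "diophantine_const 1 c = (\<Union>m. diophantine_const 1 c \<inter> {real_of_int m..<real_of_int m + 1})"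
  proof -
    have "(\<Union>m. {real_of_int m..<real_of_int m + 1}) = UNIV"
    proof (intro equalityI subset_UNIV subsetI UN_I UNIV_I)
      show "x \<in> {real_of_int \<lfloor>x\<rfloor>..<real_of_int \<lfloor>x\<rfloor> + 1}" for x by simp
    qed
    then show ?thesis by (simp only: Int_UN_distrib[symmetric] Int_UNIV_right)
  qed
  ultimately show ?thesis by (subst eq) assumption
qed

lemma null_sets_diophantine_1: "diophantine 1 \<in> null_sets lborel"
  unfolding diophantine_eq_Union by (rule null_sets_UN, rule null_sets_diophantine_const) simp_all

section \<open>Null sets of time differences give null sets in the plane\<close>

text \<open>
  Fubini: each vertical section is an affine image of \<open>N\<close>.
\<close>

lemma null_sets_shear:
  fixes N :: "real set"
  assumes N: "N \<in> null_sets lborel" and k: "k \<noteq> 0"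
  shows "{(x, y). (y - x) / k \<in> N} \<in> null_sets (lborel :: (real \<times> real) measure)"
proof -
  have [measurable]: "N \<in> sets borel" using N by (simp add: null_sets_def)
  let ?A = "{(x, y). (y - x) / k \<in> N}"
  have A: "?A \<in> sets (borel :: (real \<times> real) measure)"
  proof -
    have "?A = (\<lambda>z. (snd z - fst z) / k) -` N \<inter> space borel" by auto
    also have "\<dots> \<in> sets borel"
      by (rule measurable_sets[of _ borel borel])
         (auto intro!: borel_measurable_continuous_onI continuous_intros simp: k)
    finally show ?thesis .
  qed
  have fib: "emeasure lborel (Pair x -` ?A) = 0" for x
  proof -
    have "Pair x -` ?A = (\<lambda>n. x + k * n) ` N"
    proof (intro set_eqI iffI)
      fix y assume "y \<in> Pair x -` ?A"
      then have "(y - x) / k \<in> N" "y = x + k * ((y - x) / k)" using k by auto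
      then show "y \<in> (\<lambda>n. x + k * n) ` N" by blast
    qed (use k in auto)
    moreover have "negligible ((\<lambda>n. x + k * n) ` N)"
      using N by (intro negligible_differentiable_image_negligible)
        (auto intro!: derivative_intros simp: negligible_iff_null_sets null_sets_completionI)
    moreover have "Pair x -` ?A \<in> sets borel"
      using sets_Pair1[of ?A borel borel x] A by (simp add: borel_prod)
    ultimately show ?thesis
      using null_setsD1[of "Pair x -` ?A" lebesgue] emeasure_completion[of "Pair x -` ?A" lborel]
      by (simp add: negligible_iff_null_sets)
  qed
  have "emeasure (lborel \<Otimes>\<^sub>M lborel) ?A = (\<integral>\<^sup>+x. emeasure lborel (Pair x -` ?A) \<partial>lborel)"
    by (rule lborel.emeasure_pair_measure_alt) (use A in \<open>simp only: lborel_prod sets_lborel\<close>)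
  also have "\<dots> = 0" using fib by simp
  finally show ?thesis using A by (intro null_setsI) (simp_all add: lborel_prod)
qed

section \<open>A Cantor construction of badly approximable points\<close>

text \<open>
  Three rather than two, because the intervals are closed and share their endpoints.
\<close>

lemma card_intervals_meeting_le:
  fixes S :: "real set" and a h :: real
  assumes h: "0 < h" and S: "\<And>x y. x \<in> S \<Longrightarrow> y \<in> S \<Longrightarrow> \<bar>x - y\<bar> \<le> h"
  shows "card {j. j < R \<and> S \<inter> {a + real j * h..a + real j * h + h} \<noteq> {}} \<le> 3"
proof (cases "{j. j < R \<and> S \<inter> {a + real j * h..a + real j * h + h} \<noteq> {}} = {}")
  case True
  show ?thesis unfolding True by simp
next
  case False
  let ?J = "{j. j < R \<and> S \<inter> {a + real j * h..a + real j * h + h} \<noteq> {}}"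
  define m where "m = (LEAST j. j \<in> ?J)"
  obtain j0 where "j0 \<in> ?J" using False by blast
  then have m: "m \<in> ?J" unfolding m_def by (rule LeastI)
  then obtain x where x: "x \<in> S" "x \<le> a + real m * h + h" by auto
  have "?J \<subseteq> {m..m + 2}"
  proof
    fix j assume j: "j \<in> ?J"
    then obtain y where y: "y \<in> S" "a + real j * h \<le> y" by auto
    have "\<bar>y - x\<bar> \<le> h" using S x y by blast
    then have "real j * h \<le> (real m + 2) * h" using x y by (simp add: algebra_simps)
    then have "real j \<le> real m + 2" using h by simp
    moreover have "m \<le> j" unfolding m_def using j by (rule Least_le)
    ultimately show "j \<in> {m..m + 2}" by simp
  qed
  then have "card ?J \<le> card {m..m + 2}" by (intro card_mono) auto
  then show ?thesis by simp
qed

lemma rational_gap: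
  fixes p p' :: int and q q' :: nat
  assumes q: "1 \<le> q" "1 \<le> q'" and ne: "of_int p / real q \<noteq> of_int p' / real q'"
  shows "1 / (real q * real q') \<le> \<bar>of_int p / real q - of_int p' / real q'\<bar>"
proof -
  have eq: "of_int p / real q - of_int p' / real q' = of_int (p * int q' - p' * int q) / (real q * real q')"
    using q by (simp add: field_simps)
  have "p * int q' - p' * int q \<noteq> 0"
  proof
    assume "p * int q' - p' * int q = 0"
    then have "of_int p / real q - of_int p' / real q' = 0" unfolding eq by (simp only: of_int_0 div_0)
    then show False using ne by simp
  qed
  then have "1 \<le> \<bar>p * int q' - p' * int q\<bar>" by linarith
  then have "1 \<le> \<bar>real_of_int (p * int q' - p' * int q)\<bar>" by linarith
  then show ?thesis unfolding eq abs_divide using q by (simp add: divide_right_mono)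
qed

text \<open>
  The part of the line lost at generation \<open>n\<close> of the Cantor construction: what violates the
  Diophantine condition with constant \<open>1/(4R\<^sup>2)\<close> for a denominator with \<open>R\<^sup>n \<le> q\<^sup>2 < R\<^sup>n\<^sup>+\<^sup>1\<close>.
\<close>

definition rational_nbhd :: "nat \<Rightarrow> nat \<Rightarrow> real set" where
  "rational_nbhd R n = {x. \<exists>q::nat. \<exists>p::int. R ^ n \<le> q\<^sup>2 \<and> q\<^sup>2 < R ^ Suc n \<and>
      \<bar>real q * x - of_int p\<bar> < 1 / (4 * (real R)\<^sup>2) / real q}"

text \<open>
  Distinct rationals with these denominators are more than \<open>1/R\<^sup>n\<^sup>+\<^sup>1\<close> apart. If \<open>x\<close> and \<open>y\<close> were close to
  two of them, the distance would be less than \<open>1/(2R\<^sup>n\<^sup>+\<^sup>1)\<close> plus twice the radius \<open>1/(4R\<^sup>n\<^sup>+\<^sup>2)\<close>, which is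
  at most \<open>1/R\<^sup>n\<^sup>+\<^sup>1\<close>. So both points are close to the same rational.
\<close>

lemma rational_nbhd_diam:
  assumes R: "2 \<le> R"
    and x: "x \<in> rational_nbhd R n" and y: "y \<in> rational_nbhd R n"
    and xy: "\<bar>x - y\<bar> \<le> 1 / (2 * real R * real R ^ n)"
  shows "\<bar>x - y\<bar> \<le> 1 / (2 * real R * real R ^ Suc n)"
proof -
  define T where "T = real R ^ n"
  have T: "0 < T" using R by (simp add: T_def)
  have R': "2 \<le> real R" using R by linarith
  have near: "\<exists>q p. 1 \<le> q \<and> T \<le> (real q)\<^sup>2 \<and> (real q)\<^sup>2 < real R * T \<and>
      \<bar>z - of_int p / real q\<bar> < 1 / (4 * (real R)\<^sup>2 * T)" if z: "z \<in> rational_nbhd R n" for z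
  proof -
    obtain q :: nat and p :: int where q: "R ^ n \<le> q\<^sup>2" "q\<^sup>2 < R ^ Suc n"
      and p: "\<bar>real q * z - of_int p\<bar> < 1 / (4 * (real R)\<^sup>2) / real q"
      using z by (auto simp: rational_nbhd_def)
    have "0 < R ^ n" using R by simp
    then have q1: "1 \<le> q" using q(1) by (cases q) (auto simp del: zero_less_power_eq)
    have qT: "T \<le> (real q)\<^sup>2" "(real q)\<^sup>2 < real R * T"
      using q unfolding T_def by (simp_all flip: of_nat_power of_nat_mult)
    have "\<bar>z - of_int p / real q\<bar> = \<bar>real q * z - of_int p\<bar> / real q"
      using q1 by (simp add: field_simps abs_if)
    also have "\<dots> < 1 / (4 * (real R)\<^sup>2) / real q / real q"
      using p q1 by (intro divide_strict_right_mono) auto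
    also have "\<dots> = 1 / (4 * (real R)\<^sup>2 * (real q)\<^sup>2)" by (simp add: power2_eq_square mult_ac)
    also have "\<dots> \<le> 1 / (4 * (real R)\<^sup>2 * T)"
      using qT T R' q1 by (intro divide_left_mono mult_left_mono mult_pos_pos) auto
    finally show ?thesis using q1 qT by blast
  qed
  obtain q p where q: "1 \<le> q" "(real q)\<^sup>2 < real R * T"
    and p: "\<bar>x - of_int p / real q\<bar> < 1 / (4 * (real R)\<^sup>2 * T)" using near[OF x] by blast
  obtain q' p' where q': "1 \<le> q'" "(real q')\<^sup>2 < real R * T"
    and p': "\<bar>y - of_int p' / real q'\<bar> < 1 / (4 * (real R)\<^sup>2 * T)" using near[OF y] by blast
  define u where "u = 1 / (4 * (real R)\<^sup>2 * T)"
  have same: "of_int p / real q = of_int p' / real q'"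
  proof (rule ccontr)
    assume "of_int p / real q \<noteq> of_int p' / real q'"
    then have "1 / (real q * real q') \<le> \<bar>of_int p / real q - of_int p' / real q'\<bar>"
      using q q' by (intro rational_gap) auto
    also have "\<dots> < \<bar>x - y\<bar> + u + u" using p p' unfolding u_def by linarith
    also have "\<dots> \<le> 1 / (2 * real R * T) + u + u" using xy by (simp add: T_def)
    also have "\<dots> = (2 * real R + 2) / (4 * (real R)\<^sup>2 * T)"
      using T R' by (simp add: u_def field_simps power2_eq_square)
    also have "\<dots> \<le> (4 * real R) / (4 * (real R)\<^sup>2 * T)"
      using T R' by (intro divide_right_mono) auto
    also have "\<dots> = 1 / (real R * T)" using R' by (simp add: power2_eq_square)
    finally have "1 / (real q * real q') < 1 / (real R * T)" .
    then have "real R * T < real q * real q'" using T R' q q' by (simp add: field_simps)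
    moreover have "(real q * real q')\<^sup>2 < (real R * T)\<^sup>2"
      using q q' T R' unfolding power_mult_distrib[of "real q"] power2_eq_square[of "real R * T"]
      by (intro mult_strict_mono) auto
    then have "real q * real q' < real R * T"
      by (rule power_less_imp_less_base) (use T in simp)
    ultimately show False by simp
  qed
  then have "\<bar>x - y\<bar> \<le> u + u" using p p' unfolding u_def by linarith
  also have "u + u = 1 / (2 * real R * real R ^ Suc n)"
    by (simp add: u_def T_def power2_eq_square field_simps)
  finally show ?thesis .
qed

text \<open>
  The weight \<open>w i\<close> stands for a power of the diameter of \<open>V i\<close>; the sum measures how much of the cover
  \<open>V\<close> is relevant to \<open>Q\<close>.
\<close>

definition met_weight :: "(nat \<Rightarrow> 'a set) \<Rightarrow> (nat \<Rightarrow> real) \<Rightarrow> 'a set \<Rightarrow> real" where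
  "met_weight V w Q = (\<Sum>i. if V i \<inter> Q = {} then 0 else w i)"

context
  fixes V :: "nat \<Rightarrow> 'a set" and w :: "nat \<Rightarrow> real"
  assumes w: "\<And>i. 0 < w i" and sm: "summable w"
begin

lemma summable_met_weight: "summable (\<lambda>i. if V i \<inter> Q = {} then 0 else w i)"
  by (rule summable_comparison_test'[OF sm, of 0]) (use w in \<open>auto simp: less_imp_le\<close>)

lemma met_weight_le_suminf: "met_weight V w Q \<le> suminf w"
  unfolding met_weight_def by (intro suminf_le summable_met_weight sm) (use w in \<open>auto simp: less_imp_le\<close>)

lemma weight_le_met_weight:
  assumes "V i \<inter> Q \<noteq> {}"
  shows "w i \<le> met_weight V w Q"
proof -
  have "(\<Sum>j\<in>{i}. if V j \<inter> Q = {} then 0 else w j) \<le> met_weight V w Q"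
    unfolding met_weight_def
    by (intro sum_le_suminf summable_met_weight) (use w in \<open>auto simp: less_imp_le\<close>)
  then show ?thesis using assms by simp
qed

text \<open>
  Double counting: summed over \<open>G\<close>, the weights of the sets \<open>C g\<close> count each \<open>V i\<close> at most \<open>K\<close> times.
\<close>

lemma met_weight_pigeonhole:
  fixes C :: "'g \<Rightarrow> 'a set"
  assumes G: "finite G" "G \<noteq> {}" and sub: "\<And>g. g \<in> G \<Longrightarrow> C g \<subseteq> Q"
    and card: "\<And>i. V i \<inter> Q \<noteq> {} \<Longrightarrow> card {g\<in>G. V i \<inter> C g \<noteq> {}} \<le> K"
  shows "\<exists>g\<in>G. real (card G) * met_weight V w (C g) \<le> real K * met_weight V w Q"
proof (rule ccontr)
  assume "\<not> ?thesis"
  then have "real K * met_weight V w Q < real (card G) * met_weight V w (C g)" if "g \<in> G" for g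
    using that by (simp add: not_le)
  then have "(\<Sum>g\<in>G. real K * met_weight V w Q) < (\<Sum>g\<in>G. real (card G) * met_weight V w (C g))"
    using G by (intro sum_strict_mono) auto
  also have "\<dots> = real (card G) * (\<Sum>g\<in>G. met_weight V w (C g))" by (simp add: sum_distrib_left)
  finally have "real (card G) * (real K * met_weight V w Q) < real (card G) * (\<Sum>g\<in>G. met_weight V w (C g))"
    by simp
  then have "real K * met_weight V w Q < (\<Sum>g\<in>G. met_weight V w (C g))"
    using G by (simp add: mult_less_cancel_left_pos card_gt_0_iff)
  also have "\<dots> = (\<Sum>i. \<Sum>g\<in>G. if V i \<inter> C g = {} then 0 else w i)"
    unfolding met_weight_def by (rule suminf_sum[symmetric]) (rule summable_met_weight)
  also have "\<dots> \<le> (\<Sum>i. real K * (if V i \<inter> Q = {} then 0 else w i))"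
  proof (intro suminf_le summable_sum summable_mult summable_met_weight)
    fix i
    have "(\<Sum>g\<in>G. if V i \<inter> C g = {} then 0 else w i) = (\<Sum>g\<in>{g\<in>G. V i \<inter> C g \<noteq> {}}. w i)"
      using G(1) by (subst sum.inter_filter) (auto intro!: sum.cong)
    also have "\<dots> \<le> real K * (if V i \<inter> Q = {} then 0 else w i)"
    proof (cases "V i \<inter> Q = {}")
      case True
      then have none: "{g\<in>G. V i \<inter> C g \<noteq> {}} = {}" using sub by blast
      show ?thesis unfolding none by (simp add: True)
    next
      case False
      then show ?thesis using card[OF False] w[of i] by simp
    qed
    finally show "(\<Sum>g\<in>G. if V i \<inter> C g = {} then 0 else w i) \<le> real K * (if V i \<inter> Q = {} then 0 else w i)" .
  qed
  also have "\<dots> = real K * met_weight V w Q"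
    unfolding met_weight_def by (rule suminf_mult) (rule summable_met_weight)
  finally show False by simp
qed

end

definition square :: "real \<times> real \<Rightarrow> real \<Rightarrow> (real \<times> real) set" where
  "square z L = {fst z..fst z + L} \<times> {snd z..snd z + L}"

text \<open>
  The side of the squares of generation \<open>n\<close>. The factor \<open>1/(2R)\<close> keeps a generation-\<open>n\<close> square shorter
  than the gaps between the rationals removed at that generation.
\<close>

definition side :: "nat \<Rightarrow> nat \<Rightarrow> real" where
  "side R n = 1 / (2 * real R * real R ^ n)"

lemma side_pos: "0 < R \<Longrightarrow> 0 < side R n"
  by (simp add: side_def)

lemma side_Suc: "0 < R \<Longrightarrow> side R n = real R * side R (Suc n)"
  by (simp add: side_def)

lemma side_tendsto_0:
  assumes R: "2 \<le> R"
  shows "side R \<longlonglongrightarrow> 0"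
proof -
  have "(\<lambda>n. 1 / (2 * real R) * inverse (real R) ^ n) \<longlonglongrightarrow> 1 / (2 * real R) * 0"
    using R by (intro tendsto_intros LIMSEQ_power_zero) (simp add: inverse_less_1_iff)
  then show ?thesis by (simp add: side_def[abs_def] field_simps power_inverse[symmetric])
qed

lemma subsquare_subset:
  assumes "i < R" "j < R" "0 \<le> h"
  shows "square (a + real i * h, b + real j * h) h \<subseteq> square (a, b) (real R * h)"
proof -
  have "real i * h + h \<le> real R * h" if "i < R" for i
  proof -
    have "(real i + 1) * h \<le> real R * h" using that assms by (intro mult_right_mono) auto
    then show ?thesis by (simp add: algebra_simps)
  qed
  from this[OF assms(1)] this[OF assms(2)] show ?thesis
    using assms unfolding square_def by (intro Sigma_mono) auto
qed

lemma card_subsquares_meeting_le: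
  assumes h: "0 < h" and J: "J \<subseteq> {..<R}"
    and V: "\<And>u v. u \<in> V \<Longrightarrow> v \<in> V \<Longrightarrow> \<bar>fst u - fst v\<bar> \<le> h \<and> \<bar>snd u - snd v\<bar> \<le> h"
  shows "card {g \<in> {..<R} \<times> J. V \<inter> square (a + real (fst g) * h, b + real (snd g) * h) h \<noteq> {}} \<le> 9"
proof -
  let ?I = "\<lambda>S c. {j. j < R \<and> S \<inter> {c + real j * h..c + real j * h + h} \<noteq> {}}"
  have "card (?I (fst ` V) a) \<le> 3" "card (?I (snd ` V) b) \<le> 3"
    using V by (auto intro!: card_intervals_meeting_le h)
  then have "card (?I (fst ` V) a \<times> ?I (snd ` V) b) \<le> 3 * 3"
    unfolding card_cartesian_product by (rule mult_le_mono)
  moreover have "card {g \<in> {..<R} \<times> J. V \<inter> square (a + real (fst g) * h, b + real (snd g) * h) h \<noteq> {}}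
      \<le> card (?I (fst ` V) a \<times> ?I (snd ` V) b)"
  proof (rule card_mono)
    show "{g \<in> {..<R} \<times> J. V \<inter> square (a + real (fst g) * h, b + real (snd g) * h) h \<noteq> {}}
      \<subseteq> ?I (fst ` V) a \<times> ?I (snd ` V) b"
    proof
      fix g assume "g \<in> {g \<in> {..<R} \<times> J. V \<inter> square (a + real (fst g) * h, b + real (snd g) * h) h \<noteq> {}}"
      then have gJ: "g \<in> {..<R} \<times> J" and ne: "V \<inter> square (a + real (fst g) * h, b + real (snd g) * h) h \<noteq> {}"
        by simp_all
      from gJ J have g: "fst g < R" "snd g < R" by (auto simp: mem_Times_iff)
      from ne obtain v where v: "v \<in> V" "v \<in> square (a + real (fst g) * h, b + real (snd g) * h) h" by blast
      have "fst v \<in> fst ` V \<inter> {a + real (fst g) * h..a + real (fst g) * h + h}"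
        "snd v \<in> snd ` V \<inter> {b + real (snd g) * h..b + real (snd g) * h + h}"
        using v by (auto simp: square_def)
      then show "g \<in> ?I (fst ` V) a \<times> ?I (snd ` V) b"
        using g unfolding mem_Times_iff by blast
    qed
  qed auto
  ultimately show ?thesis by linarith
qed

context
  fixes V :: "nat \<Rightarrow> (real \<times> real) set" and w :: "nat \<Rightarrow> real" and d :: real and R :: nat
  assumes w: "\<And>i. 0 < w i" and sm: "summable w" and d: "0 < d"
    and R: "4 \<le> R" "9 * real R powr d \<le> real R * (real R - 3)"
    and V: "\<And>i u v. u \<in> V i \<Longrightarrow> v \<in> V i \<Longrightarrow> \<bar>fst u - fst v\<bar> powr d \<le> w i \<and> \<bar>snd u - snd v\<bar> powr d \<le> w i"
begin

text \<open>
  The invariant bounds the weight met by a square by the \<open>d\<close>-th power of the \<^emph>\<open>next\<close> side. Hence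
  every member of the cover that meets the square has diameter at most the side of the subsquares,
  and meets at most nine of them; the pigeonhole principle over the at least \<open>R(R - 3)\<close> admissible
  subsquares then recovers the invariant one generation later.
\<close>

lemma subsquare_step:
  assumes Q: "met_weight V w (square z (side R n)) \<le> side R (Suc n) powr d"
  shows "\<exists>z'. met_weight V w (square z' (side R (Suc n))) \<le> side R (Suc (Suc n)) powr d \<and>
    square z' (side R (Suc n)) \<subseteq> square z (side R n) \<and>
    {snd z'..snd z' + side R (Suc n)} \<inter> rational_nbhd R n = {}"
proof -
  define h where "h = side R (Suc n)"
  have R0: "0 < R" using R by simp
  have h: "0 < h" "side R n = real R * h" 
    unfolding h_def by (rule side_pos[OF R0], rule side_Suc[OF R0])
  define a b where "a = fst z" and "b = snd z"
  have z: "z = (a, b)" by (simp add: a_def b_def)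
  define N where "N = rational_nbhd R n \<inter> {b..b + side R n}"
  let ?row = "\<lambda>j. {b + real j * h..b + real j * h + h}"
  define B where "B = {j. j < R \<and> N \<inter> ?row j \<noteq> {}}"
  define J where "J = {..<R} - B"
  define C where "C g = square (a + real (fst g) * h, b + real (snd g) * h) h" for g :: "nat \<times> nat"
  have cardB: "card B \<le> 3" unfolding B_def
  proof (rule card_intervals_meeting_le[OF h(1)])
    fix x y assume x: "x \<in> N" and y: "y \<in> N"
    then have "\<bar>x - y\<bar> \<le> side R n" unfolding N_def by auto
    then show "\<bar>x - y\<bar> \<le> h" using rational_nbhd_diam[of R x n y] x y R unfolding N_def h_def side_def by auto
  qed
  have J: "J \<subseteq> {..<R}" by (auto simp: J_def)
  have "card J = R - card B" unfolding J_def by (subst card_Diff_subset) (auto simp: B_def)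
  then have cardJ: "real R - 3 \<le> real (card J)" using cardB by linarith
  have cardG: "real R * (real R - 3) \<le> real (card ({..<R} \<times> J))"
    unfolding card_cartesian_product of_nat_mult using cardJ by (simp add: mult_left_mono)
  have pos: "0 < real R * (real R - 3)" using R by simp
  have sub: "C g \<subseteq> square z (side R n)" if "g \<in> {..<R} \<times> J" for g
    unfolding C_def z h(2) using that J h by (intro subsquare_subset) auto
  have meet: "card {g \<in> {..<R} \<times> J. V i \<inter> C g \<noteq> {}} \<le> 9" if "V i \<inter> square z (side R n) \<noteq> {}" for i
    unfolding C_def
  proof (rule card_subsquares_meeting_le[OF h(1) J])
    have "w i \<le> h powr d" using weight_le_met_weight[of w V i, OF w sm that] Q by (simp add: h_def)
    moreover have "x \<le> h" if "x powr d \<le> h powr d" for x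
      using powr_less_mono2[of d h x] d h that by (meson less_imp_le not_le)
    ultimately show "\<bar>fst u - fst v\<bar> \<le> h \<and> \<bar>snd u - snd v\<bar> \<le> h" if "u \<in> V i" "v \<in> V i" for u v
      using V[OF that] by (meson order_trans)
  qed
  have fin: "finite ({..<R} \<times> J)" "{..<R} \<times> J \<noteq> {}"
  proof -
    show "finite ({..<R} \<times> J)" by (simp add: J_def)
    show "{..<R} \<times> J \<noteq> {}" using cardG pos by (intro notI) simp
  qed
  obtain g where g: "g \<in> {..<R} \<times> J"
    and le: "real (card ({..<R} \<times> J)) * met_weight V w (C g) \<le> real 9 * met_weight V w (square z (side R n))"
    using met_weight_pigeonhole[of w "{..<R} \<times> J" C "square z (side R n)" V 9, OF w sm fin sub meet] by blast
  have nonneg: "0 \<le> met_weight V w (C g)"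
    unfolding met_weight_def by (intro suminf_nonneg summable_met_weight[of w V, OF w sm]) (use w in \<open>auto simp: less_imp_le\<close>)
  have "9 * real R powr d * met_weight V w (C g) \<le> real (card ({..<R} \<times> J)) * met_weight V w (C g)"
    using R(2) cardG nonneg by (intro mult_right_mono) linarith+
  also have "\<dots> \<le> 9 * h powr d" using le Q by (simp add: h_def)
  finally have "real R powr d * met_weight V w (C g) \<le> h powr d" by simp
  also have "h powr d = real R powr d * side R (Suc (Suc n)) powr d"
    using side_Suc[OF R0, of "Suc n"] side_pos[OF R0, of "Suc (Suc n)"] by (simp add: h_def powr_mult)
  finally have "met_weight V w (C g) \<le> side R (Suc (Suc n)) powr d" using R0 by simp
  moreover have "{b + real (snd g) * h..b + real (snd g) * h + h} \<inter> rational_nbhd R n = {}"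
  proof -
    have "snd g < R" "snd g \<notin> B" using g by (auto simp: J_def)
    then have "N \<inter> ?row (snd g) = {}" by (simp add: B_def)
    moreover have "?row (snd g) \<subseteq> {b..b + side R n}"
    proof -
      have "(real (snd g) + 1) * h \<le> real R * h" using \<open>snd g < R\<close> h by (intro mult_right_mono) auto
      then show ?thesis using h by (auto simp: algebra_simps)
    qed
    ultimately show ?thesis unfolding N_def by blast
  qed
  ultimately show ?thesis
    using sub[OF g] unfolding C_def h_def[symmetric]
    by (intro exI[of _ "(a + real (fst g) * h, b + real (snd g) * h)"]) simp
qed

text \<open>
  The nested squares shrink to a point \<open>z\<close>. Its second coordinate avoids the rational neighbourhoods
  of all generations, and these exhaust all denominators. If \<open>V i\<close> contained \<open>z\<close>, it would meet
  all the squares, so the invariant would force its positive weight below every bound.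
\<close>

lemma badly_approximable_uncovered:
  assumes small: "suminf w \<le> side R 1 powr d"
  shows "\<exists>z. snd z \<in> diophantine 1 \<and> (\<forall>i. z \<notin> V i)"
proof -
  have "\<exists>f. \<forall>n. met_weight V w (square (f n) (side R n)) \<le> side R (Suc n) powr d \<and>
    (square (f (Suc n)) (side R (Suc n)) \<subseteq> square (f n) (side R n) \<and>
    {snd (f (Suc n))..snd (f (Suc n)) + side R (Suc n)} \<inter> rational_nbhd R n = {})"
  proof (rule dependent_nat_choice)
    show "\<exists>z. met_weight V w (square z (side R 0)) \<le> side R (Suc 0) powr d"
      using met_weight_le_suminf[of w V, OF w sm] small by (metis One_nat_def order_trans)
  qed (use subsquare_step in blast)
  then obtain f where f: "\<And>n. met_weight V w (square (f n) (side R n)) \<le> side R (Suc n) powr d"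
    "\<And>n. square (f (Suc n)) (side R (Suc n)) \<subseteq> square (f n) (side R n)"
    "\<And>n. {snd (f (Suc n))..snd (f (Suc n)) + side R (Suc n)} \<inter> rational_nbhd R n = {}"
    by blast
  have R0: "0 < R" using R by simp
  have "\<Inter>(range (\<lambda>n. square (f n) (side R n))) \<noteq> {}"
  proof (rule compact_nest)
    show "compact (square (f n) (side R n))" for n unfolding square_def by (intro compact_Times compact_Icc)
    show "square (f n) (side R n) \<noteq> {}" for n
      using side_pos[OF R0, of n] by (simp add: square_def)
    show "square (f n) (side R n) \<subseteq> square (f m) (side R m)" if "m \<le> n" for m n
      by (rule lift_Suc_antimono_le[of "\<lambda>n. square (f n) (side R n)", OF f(2) that])
  qed
  then obtain z where z: "\<And>n. z \<in> square (f n) (side R n)" by blast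
  have "snd z \<in> diophantine_const 1 (1 / (4 * (real R)\<^sup>2))"
    unfolding diophantine_const_def
  proof (intro CollectI allI impI)
    fix q :: nat and p :: int assume q: "1 \<le> q"
    then have "1 \<le> q\<^sup>2" by simp
    then obtain n where n: "R ^ n \<le> q\<^sup>2" "q\<^sup>2 < R ^ Suc n" using ex_power_ivl1[of R "q\<^sup>2"] R by auto
    have "snd z \<in> {snd (f (Suc n))..snd (f (Suc n)) + side R (Suc n)}"
      using z[of "Suc n"] unfolding square_def by auto
    then have "snd z \<notin> rational_nbhd R n" using f(3)[of n] by blast
    then have "\<not> \<bar>real q * snd z - of_int p\<bar> < 1 / (4 * (real R)\<^sup>2) / real q"
      using n unfolding rational_nbhd_def by blast
    then show "1 / (4 * (real R)\<^sup>2) * real q powr - 1 \<le> \<bar>real q * snd z - of_int p\<bar>"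
      by (simp add: powr_minus_divide not_less)
  qed
  then have "snd z \<in> diophantine 1" using R0 by (auto simp: diophantine_def)
  moreover have "z \<notin> V i" for i
  proof
    assume zV: "z \<in> V i"
    have "w i \<le> side R (Suc n) powr d" for n
    proof -
      have "V i \<inter> square (f n) (side R n) \<noteq> {}" using zV z by blast
      from order_trans[OF weight_le_met_weight[of w V i, OF w sm this] f(1)] show ?thesis .
    qed
    moreover have "(\<lambda>n. side R (Suc n) powr d) \<longlonglongrightarrow> 0"
    proof -
      have "(\<lambda>n. side R (Suc n) powr d) \<longlonglongrightarrow> 0 powr d"
      proof (rule tendsto_powr2[OF _ tendsto_const _ d])
        show "(\<lambda>n. side R (Suc n)) \<longlonglongrightarrow> 0"
          by (rule LIMSEQ_Suc, rule side_tendsto_0) (use R in simp)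
        show "\<forall>\<^sub>F n in sequentially. 0 \<le> side R (Suc n)"
          using side_pos[OF R0] by (simp add: less_imp_le)
      qed
      then show ?thesis by simp
    qed
    ultimately have "w i \<le> 0" by (intro LIMSEQ_le_const) auto
    then show False using w[of i] by simp
  qed
  ultimately show ?thesis by blast
qed

end

text \<open>
  For \<open>R \<ge> 4\<close> one has \<open>R - 3 \<ge> R/4\<close>, so \<open>R\<^sup>d\<^sup>-\<^sup>2 < 1/36\<close> suffices.
\<close>

lemma exists_branching_number:
  assumes d: "d < 2"
  shows "\<exists>R::nat. 4 \<le> R \<and> 9 * real R powr d \<le> real R * (real R - 3)"
proof -
  have "(\<lambda>n. real n powr (d - 2)) \<longlonglongrightarrow> 0"
    by (rule tendsto_neg_powr[OF _ filterlim_real_sequentially]) (use d in simp)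
  then have "eventually (\<lambda>n. real n powr (d - 2) < 1 / 36) sequentially"
    by (rule order_tendstoD) simp
  then have "eventually (\<lambda>n. 4 \<le> n \<and> real n powr (d - 2) < 1 / 36) sequentially"
    using eventually_ge_at_top by (rule eventually_conj[rotated])
  then obtain R :: nat where R: "4 \<le> R" "real R powr (d - 2) < 1 / 36"
    by (auto dest: eventually_happens)
  have "9 * real R powr d = 9 * real R powr (d - 2) * (real R)\<^sup>2"
    using R(1) by (simp add: powr_diff)
  also have "\<dots> \<le> 9 * (1 / 36) * (real R)\<^sup>2" using R by (intro mult_right_mono mult_left_mono) auto
  also have "\<dots> = real R * (real R / 4)" by (simp add: power2_eq_square)
  also have "\<dots> \<le> real R * (real R - 3)" using R(1) by (intro mult_left_mono) auto
  finally show ?thesis using R(1) by blast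
qed

section \<open>Hausdorff dimension\<close>

lemma hausdorff_pre_measure_le:
  assumes "E \<subseteq> (\<Union>i. U i)" "\<And>i. bounded (U i)" "\<And>i. diameter (U i) \<le> \<delta>"
  shows "hausdorff_pre_measure d \<delta> E \<le> (\<Sum>i. diam_pow d (U i))"
  unfolding hausdorff_pre_measure_def using assms by (intro INF_lower) auto

text \<open>
  A lower bound for the \<open>d\<close>-dimensional Hausdorff content of the set of \<open>z\<close> with \<open>snd z\<close> badly approximable. The weights must
  be positive, which a set of diameter \<open>0\<close> would not provide by itself: hence \<open>w i\<close> is only required to dominate
  the \<open>d\<close>-th power of the extent of \<open>V i\<close>.
\<close>

lemma uncovered_badly_approximable:
  assumes "0 < d" "d < 2"
  shows "\<exists>\<eta>>0. \<forall>V w. (\<forall>i. 0 < w i) \<and> summable w \<and> suminf w \<le> \<eta> \<and>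
    (\<forall>i. \<forall>u\<in>V i. \<forall>v\<in>V i. \<bar>fst u - fst v\<bar> powr d \<le> w i \<and> \<bar>snd u - snd v\<bar> powr d \<le> w i) \<longrightarrow>
    (\<exists>z :: real \<times> real. snd z \<in> diophantine 1 \<and> (\<forall>i::nat. z \<notin> V i))"
proof -
  obtain R :: nat where R: "4 \<le> R" "9 * real R powr d \<le> real R * (real R - 3)"
    using exists_branching_number[OF assms(2)] by blast
  show ?thesis
  proof (intro exI[of _ "side R 1 powr d"] conjI allI impI)
    show "0 < side R 1 powr d" using side_pos[of R 1] R(1) by simp
    fix V :: "nat \<Rightarrow> (real \<times> real) set" and w :: "nat \<Rightarrow> real"
    assume *: "(\<forall>i. 0 < w i) \<and> summable w \<and> suminf w \<le> side R 1 powr d \<and>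
      (\<forall>i. \<forall>u\<in>V i. \<forall>v\<in>V i. \<bar>fst u - fst v\<bar> powr d \<le> w i \<and> \<bar>snd u - snd v\<bar> powr d \<le> w i)"
    show "\<exists>z :: real \<times> real. snd z \<in> diophantine 1 \<and> (\<forall>i::nat. z \<notin> V i)"
      by (rule badly_approximable_uncovered[of w d R V]) (use * assms R in auto)
  qed
qed

lemma diameter_powr_le_diam_pow:
  assumes "0 \<le> d" "d \<le> d'" "0 < d'" "bounded U" "diameter U \<le> 1"
  shows "ennreal (diameter U powr d') \<le> diam_pow d U"
proof -
  have "diameter U powr d' \<le> diameter U powr d"
    using assms diameter_ge_0 by (intro powr_mono') auto
  moreover have "diameter U powr d' \<le> 1"
    using assms diameter_ge_0[of U] powr_mono2[of d' "diameter U" 1] by simp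
  ultimately show ?thesis
    using assms by (auto simp: diam_pow_def intro: ennreal_leI)
qed

text \<open>
  The map \<open>(u, x) \<mapsto> (u, u + \<pi>x)\<close> carries pairs with \<open>x\<close> badly approximable to the given set, and
  pulling back along it does not increase coordinate-wise extents. The exponent \<open>d\<close> is replaced by some
  \<open>d' > 0\<close> with \<open>d \<le> d' < 2\<close>, which treats \<open>d = 0\<close> like all other values.
\<close>

lemma hausdorff_measure_badly_approximable:
  assumes d: "0 \<le> d" "d < 2"
  shows "hausdorff_measure d {(t0, t1). (t1 - t0) / pi \<in> diophantine 1} \<noteq> 0"
proof
  let ?E = "{(t0, t1). (t1 - t0) / pi \<in> diophantine 1}"
  assume "hausdorff_measure d ?E = 0"
  define d' where "d' = (d + 2) / 2"
  have d': "0 < d'" "d' < 2" "d \<le> d'" using d by (auto simp: d'_def)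
  obtain \<eta> where \<eta>: "\<eta> > 0" and *: "\<And>V w. (\<And>i. 0 < w i) \<Longrightarrow> summable w \<Longrightarrow> suminf w \<le> \<eta> \<Longrightarrow>
    (\<And>i u v. u \<in> V i \<Longrightarrow> v \<in> V i \<Longrightarrow> \<bar>fst u - fst v\<bar> powr d' \<le> w i \<and> \<bar>snd u - snd v\<bar> powr d' \<le> w i) \<Longrightarrow>
    (\<exists>z :: real \<times> real. snd z \<in> diophantine 1 \<and> (\<forall>i::nat. z \<notin> V i))"
    using uncovered_badly_approximable[OF d'(1,2)] by metis
  have "hausdorff_pre_measure d 1 ?E \<le> hausdorff_measure d ?E"
    unfolding hausdorff_measure_def by (rule SUP_upper) simp
  then have "hausdorff_pre_measure d 1 ?E < ennreal (\<eta> / 2)"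
    using \<open>hausdorff_measure d ?E = 0\<close> \<eta> by simp
  then obtain U where cov: "?E \<subseteq> (\<Union>i. U i)" and U: "\<And>i. bounded (U i)" "\<And>i. diameter (U i) \<le> 1"
    and sum: "(\<Sum>i. diam_pow d (U i)) < ennreal (\<eta> / 2)"
    unfolding hausdorff_pre_measure_def INF_less_iff by auto
  define x where "x i = diameter (U i) powr d'" for i
  have le: "(\<Sum>i. ennreal (x i)) \<le> (\<Sum>i. diam_pow d (U i))"
    unfolding x_def using d d' U by (intro suminf_le diameter_powr_le_diam_pow) auto
  have sx: "summable x"
    by (rule summable_suminf_not_top) (use le sum in \<open>auto simp: x_def top_unique\<close>)
  have "ennreal (suminf x) = (\<Sum>i. ennreal (x i))"
    by (rule suminf_ennreal2[symmetric, OF _ sx]) (simp add: x_def)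
  with le sum have "ennreal (suminf x) < ennreal (\<eta> / 2)" by simp
  then have x2: "suminf x \<le> \<eta> / 2" using \<eta> by (simp add: ennreal_less_iff suminf_nonneg sx x_def)
  \<comment> \<open>The summable extra term makes the weights of sets of diameter \<open>0\<close> positive.\<close>
  define w where "w i = x i + \<eta> / 2 * (1 / 2) ^ Suc i" for i
  have "(\<lambda>i. \<eta> / 2 * (1 / 2) ^ Suc i) sums (\<eta> / 2 * 1)" by (rule sums_mult[OF power_half_series])
  from sums_add[OF summable_sums[OF sx] this]
  have ws: "w sums (suminf x + \<eta> / 2)" unfolding w_def[abs_def] by simp
  have wpos: "0 < w i" for i using \<eta> by (simp add: w_def x_def add_nonneg_pos)
  define V where "V i = {z. (fst z, fst z + pi * snd z) \<in> U i}" for i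
  have V: "\<bar>fst u - fst v\<bar> powr d' \<le> w i \<and> \<bar>snd u - snd v\<bar> powr d' \<le> w i" if "u \<in> V i" "v \<in> V i" for i u v
  proof -
    let ?D = "diameter (U i)"
    let ?P = "(fst u, fst u + pi * snd u)" and ?Q = "(fst v, fst v + pi * snd v)"
    have D: "dist ?P ?Q \<le> ?D" using that U by (intro diameter_bounded_bound) (auto simp: V_def)
    have 1: "\<bar>fst u - fst v\<bar> \<le> ?D" using dist_fst_le[of ?P ?Q] D by (simp add: dist_real_def)
    have 2: "\<bar>(fst u + pi * snd u) - (fst v + pi * snd v)\<bar> \<le> ?D"
      using dist_snd_le[of ?P ?Q] D by (simp add: dist_real_def)
    have "2 * \<bar>snd u - snd v\<bar> \<le> pi * \<bar>snd u - snd v\<bar>"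
      using pi_ge_two by (intro mult_right_mono) auto
    also have "\<dots> = \<bar>pi * snd u - pi * snd v\<bar>" by (simp add: abs_mult flip: right_diff_distrib)
    also have "\<dots> \<le> 2 * ?D" using 1 2 by linarith
    finally have 3: "\<bar>snd u - snd v\<bar> \<le> ?D" by simp
    have "x i \<le> w i" using \<eta> by (simp add: w_def)
    then show ?thesis
      using powr_mono2[of d' _ ?D, OF _ _ 1] powr_mono2[of d' _ ?D, OF _ _ 3] d' unfolding x_def by auto
  qed
  have "suminf w \<le> \<eta>" using sums_unique[OF ws] x2 by simp
  from *[OF wpos sums_summable[OF ws] this V]
  obtain z where z: "snd z \<in> diophantine 1" "\<And>i. z \<notin> V i" by blast
  have "(fst z, fst z + pi * snd z) \<in> ?E" using z(1) by simp
  then show False using cov z(2) unfolding V_def by blast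
qed

text \<open>
  The squares are numbered by \<open>k = i N + j\<close>, and the sequence is padded with empty sets, which
  contribute nothing to the sum.
\<close>

lemma square_grid:
  fixes d m :: real and N :: nat
  assumes N: "0 < N" and m: "0 < m" and d: "0 < d"
  defines "s \<equiv> 2 * m / real N"
  defines "Q k \<equiv> (if k < N * N then square (- m + real (k div N) * s, - m + real (k mod N) * s) s else {})"
  shows "{- m..<m} \<times> {- m..<m} \<subseteq> (\<Union>k. Q k)"
    and "bounded (Q k)" and "diameter (Q k) \<le> 2 * s"
    and "(\<Sum>k. diam_pow d (Q k)) \<le> ennreal (real N ^ 2 * (2 * s) powr d)"
proof -
  have s: "0 < s" "real N * s = 2 * m" using N m by (simp_all add: s_def)
  show bd: "bounded (Q k)" for k
    unfolding Q_def square_def by (auto intro!: bounded_Times)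
  show diam: "diameter (Q k) \<le> 2 * s" for k
  proof (rule diameter_le)
    fix u v assume "u \<in> Q k" "v \<in> Q k"
    then have "\<bar>fst u - fst v\<bar> \<le> s" "\<bar>snd u - snd v\<bar> \<le> s"
      by (auto simp: Q_def square_def split: if_splits)
    moreover have "norm (u - v) \<le> norm (fst (u - v)) + norm (snd (u - v))"
      using norm_Pair_le[of "fst (u - v)" "snd (u - v)"] unfolding prod.collapse .
    ultimately show "norm (u - v) \<le> 2 * s" by simp
  qed (use s in simp)
  show "{- m..<m} \<times> {- m..<m} \<subseteq> (\<Union>k. Q k)"
  proof
    fix z :: "real \<times> real" assume z: "z \<in> {- m..<m} \<times> {- m..<m}"
    have row: "\<exists>i<N. t \<in> {- m + real i * s..- m + real i * s + s}" if "t \<in> {- m..<m}" for t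
    proof -
      have "t \<in> {- m..<- m + real N * s}" using that s by simp
      then obtain i where "i < N" "t \<in> {- m + real i * s..<- m + real i * s + s}"
        unfolding interval_partition[OF s(1)] by blast
      then show ?thesis by (intro exI[of _ i]) auto
    qed
    obtain i j where i: "i < N" "fst z \<in> {- m + real i * s..- m + real i * s + s}"
      and j: "j < N" "snd z \<in> {- m + real j * s..- m + real j * s + s}"
      using row[of "fst z"] row[of "snd z"] z by (auto simp: mem_Times_iff)
    have "i * N + j < i * N + N" using j by simp
    also have "\<dots> = Suc i * N" by simp
    also have "\<dots> \<le> N * N" using i by (intro mult_le_mono1) simp
    finally have "z \<in> Q (i * N + j)" using i j N by (simp add: Q_def square_def mem_Times_iff)
    then show "z \<in> (\<Union>k. Q k)" by blast
  qed
  have "(\<Sum>k. diam_pow d (Q k)) = (\<Sum>k<N * N. diam_pow d (Q k))"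
    by (rule suminf_finite) (auto simp: Q_def diam_pow_def)
  also have "\<dots> \<le> (\<Sum>k<N * N. ennreal ((2 * s) powr d))"
  proof (rule sum_mono)
    fix k
    show "diam_pow d (Q k) \<le> ennreal ((2 * s) powr d)"
      using d diam[of k] diameter_ge_0[OF bd, of k] by (auto simp: diam_pow_def intro!: ennreal_leI powr_mono2)
  qed
  also have "\<dots> = ennreal (real N ^ 2 * (2 * s) powr d)"
    by (simp add: ennreal_mult' ennreal_of_nat_eq_real_of_nat power2_eq_square)
  finally show "(\<Sum>k. diam_pow d (Q k)) \<le> ennreal (real N ^ 2 * (2 * s) powr d)" .
qed

text \<open>
  The box \<open>[-m, m)\<^sup>2\<close> is covered by \<open>N\<^sup>2\<close> squares at the cost \<open>(4m)\<^sup>d N\<^sup>2\<^sup>-\<^sup>d\<close>, which is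
  as small as desired for large \<open>N\<close> since \<open>d > 2\<close>; the \<open>n\<close>-th box gets the budget \<open>e/2\<^sup>n\<^sup>+\<^sup>1\<close>.
\<close>

lemma hausdorff_measure_plane_eq_0:
  fixes E :: "(real \<times> real) set"
  assumes d: "2 < d"
  shows "hausdorff_measure d E = 0"
proof -
  have "hausdorff_pre_measure d \<delta> E \<le> 0 + ennreal e" if \<delta>: "0 < \<delta>" and e: "0 < e" for \<delta> e
  proof -
    have "\<exists>N::nat. 0 < N \<and> 4 * real (Suc n) / real N \<le> \<delta> \<and>
        real N ^ 2 * (4 * real (Suc n) / real N) powr d \<le> e * (1 / 2) ^ Suc n" for n
    proof -
      have "(\<lambda>N. 4 * real (Suc n) / real N) \<longlonglongrightarrow> 0"
        by (rule lim_const_over_n)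
      then have 1: "\<forall>\<^sub>F N in sequentially. 4 * real (Suc n) / real N < \<delta>"
        using \<delta> by (rule order_tendstoD)
      have "(\<lambda>N. real N powr (2 - d)) \<longlonglongrightarrow> 0"
        by (rule tendsto_neg_powr[OF _ filterlim_real_sequentially]) (use d in simp)
      then have "(\<lambda>N. (4 * real (Suc n)) powr d * real N powr (2 - d)) \<longlonglongrightarrow> (4 * real (Suc n)) powr d * 0"
        by (intro tendsto_mult tendsto_const)
      then have 2: "\<forall>\<^sub>F N in sequentially. (4 * real (Suc n)) powr d * real N powr (2 - d) < e * (1 / 2) ^ Suc n"
        by (rule order_tendstoD) (use e in simp)
      have "\<forall>\<^sub>F N::nat in sequentially. 0 < N \<and> 4 * real (Suc n) / real N < \<delta> \<and>
        (4 * real (Suc n)) powr d * real N powr (2 - d) < e * (1 / 2) ^ Suc n"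
        using eventually_gt_at_top 1 2 by (intro eventually_conj)
      then obtain N :: nat where N: "0 < N" "4 * real (Suc n) / real N < \<delta>"
        "(4 * real (Suc n)) powr d * real N powr (2 - d) < e * (1 / 2) ^ Suc n"
        by (auto dest: eventually_happens)
      moreover have "real N ^ 2 * (4 * real (Suc n) / real N) powr d = (4 * real (Suc n)) powr d * real N powr (2 - d)"
        using N(1) by (simp add: powr_divide powr_diff del: of_nat_Suc)
      ultimately show ?thesis by (intro exI[of _ N]) simp
    qed
    then obtain N :: "nat \<Rightarrow> nat" where N: "\<And>n. 0 < N n" "\<And>n. 4 * real (Suc n) / real (N n) \<le> \<delta>"
      "\<And>n. real (N n) ^ 2 * (4 * real (Suc n) / real (N n)) powr d \<le> e * (1 / 2) ^ Suc n"
      by metis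
    define Q where "Q n k = (if k < N n * N n then square (- real (Suc n) + real (k div N n) * (2 * real (Suc n) / real (N n)),
      - real (Suc n) + real (k mod N n) * (2 * real (Suc n) / real (N n))) (2 * real (Suc n) / real (N n)) else {})" for n k
    have d0: "0 < d" using d by simp
    have S: "0 < real (Suc n)" for n by simp
    have grid: "{- real (Suc n)..<real (Suc n)} \<times> {- real (Suc n)..<real (Suc n)} \<subseteq> (\<Union>k. Q n k)"
      "bounded (Q n k)" "diameter (Q n k) \<le> 2 * (2 * real (Suc n) / real (N n))"
      "(\<Sum>k. diam_pow d (Q n k)) \<le> ennreal (real (N n) ^ 2 * (2 * (2 * real (Suc n) / real (N n))) powr d)"
      for n k
      unfolding Q_def by (rule square_grid[OF N(1)[of n] S[of n] d0])+
    define U where "U i = case_prod Q (prod_decode i)" for i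
    have "hausdorff_pre_measure d \<delta> E \<le> (\<Sum>i. diam_pow d (U i))"
    proof (rule hausdorff_pre_measure_le)
      show "E \<subseteq> (\<Union>i. U i)"
      proof
        fix z assume "z \<in> E"
        obtain n where n: "max \<bar>fst z\<bar> \<bar>snd z\<bar> < real n" using reals_Archimedean2 by blast
        then have "\<bar>fst z\<bar> < real (Suc n)" "\<bar>snd z\<bar> < real (Suc n)" by simp_all
        then have "z \<in> {- real (Suc n)..<real (Suc n)} \<times> {- real (Suc n)..<real (Suc n)}"
          unfolding mem_Times_iff atLeastLessThan_iff by linarith
        then have "z \<in> (\<Union>k. Q n k)" by (rule subsetD[OF grid(1)])
        then obtain k where "z \<in> Q n k" by (rule UN_E)
        then have "z \<in> U (prod_encode (n, k))" by (simp only: U_def prod_encode_inverse case_prod_conv)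
        then show "z \<in> (\<Union>i. U i)" by (rule UN_I[OF UNIV_I])
      qed
      fix i
      obtain n k where nk: "prod_decode i = (n, k)" by fastforce
      show "bounded (U i)" unfolding U_def nk using grid(2)[of n k] by simp
      have "diameter (Q n k) \<le> 4 * real (Suc n) / real (N n)" using grid(3)[of n k] by simp
      then show "diameter (U i) \<le> \<delta>" unfolding U_def nk using N(2)[of n] by simp
    qed
    also have "\<dots> = (\<Sum>i. (\<lambda>z. diam_pow d (case_prod Q z)) (prod_decode i))" by (simp add: U_def)
    also have "\<dots> = (\<Sum>n. \<Sum>k. diam_pow d (Q n k))"
      by (rule suminf_ennreal_2dimen) simp
    also have "\<dots> \<le> (\<Sum>n. ennreal (e * (1 / 2) ^ Suc n))"
    proof (intro suminf_le)
      show "(\<Sum>k. diam_pow d (Q n k)) \<le> ennreal (e * (1 / 2) ^ Suc n)" for n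
      proof -
        have "2 * (2 * real (Suc n) / real (N n)) = 4 * real (Suc n) / real (N n)" by simp
        with order_trans[OF grid(4)[of n] ennreal_leI] N(3)[of n] show ?thesis by (simp only:)
      qed
    qed auto
    also have "\<dots> = ennreal (e * 1)"
      using e by (intro suminf_ennreal_eq sums_mult power_half_series) simp
    finally show ?thesis by simp
  qed
  then have "hausdorff_pre_measure d \<delta> E = 0" if "0 < \<delta>" for \<delta>
    using that by (meson ennreal_le_epsilon le_zero_eq)
  then show ?thesis unfolding hausdorff_measure_def by (simp add: SUP_eq_const)
qed

lemma hausdorff_dim_badly_approximable:
  "hausdorff_dim {(t0, t1). (t1 - t0) / pi \<in> diophantine 1} = 2" (is "hausdorff_dim ?E = 2")
proof (rule antisym)
  show "hausdorff_dim ?E \<le> 2"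
  proof (rule ennreal_le_epsilon)
    fix e :: real assume e: "0 < e"
    have "hausdorff_dim ?E \<le> ennreal (2 + e)"
      unfolding hausdorff_dim_def using e hausdorff_measure_plane_eq_0[of "2 + e" ?E]
      by (intro Inf_lower CollectI exI[of _ "2 + e"] conjI refl) simp_all
    then show "hausdorff_dim ?E \<le> 2 + ennreal e" using e by simp
  qed
  show "2 \<le> hausdorff_dim ?E"
    unfolding hausdorff_dim_def
  proof (rule Inf_greatest)
    fix x assume "x \<in> {ennreal d |d. 0 \<le> d \<and> hausdorff_measure d ?E = 0}"
    then obtain d where d: "x = ennreal d" "0 \<le> d" "hausdorff_measure d ?E = 0" by blast
    then have "2 \<le> d" using hausdorff_measure_badly_approximable[of d] by (meson not_le)
    then have "ennreal 2 \<le> ennreal d" by (rule ennreal_leI)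
    then show "2 \<le> x" by (simp add: d)
  qed
qed

section \<open>The strategic pairs of the string\<close>

theorem theorem3p3:
  fixes r s :: real
  assumes "s \<le> r"
  shows "(r - s < 1 \<longrightarrow> strategic_pairs r s = {}) \<and>
         (r - s = 1 \<longrightarrow> strategic_pairs r s \<in> null_sets lebesgue \<and>
                        hausdorff_dim (strategic_pairs r s) = 2) \<and>
         (r - s > 1 \<longrightarrow> - strategic_pairs r s \<in> null_sets lebesgue)"
proof (intro conjI impI)
  have eq: "strategic_pairs r s = {(t0, t1). (t1 - t0) / pi \<in> diophantine (r - s)}"
    using strategic_pairs_iff_diophantine by auto
  show "strategic_pairs r s = {}" if "r - s < 1"
    unfolding eq using diophantine_empty[of "r - s"] that assms by simp
  show "strategic_pairs r s \<in> null_sets lebesgue" if "r - s = 1"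
    unfolding eq that by (intro null_sets_completionI null_sets_shear null_sets_diophantine_1) simp
  show "hausdorff_dim (strategic_pairs r s) = 2" if "r - s = 1"
    unfolding eq that by (rule hausdorff_dim_badly_approximable)
  show "- strategic_pairs r s \<in> null_sets lebesgue" if "r - s > 1"
  proof -
    have "- strategic_pairs r s = {(t0, t1). (t1 - t0) / pi \<in> - diophantine (r - s)}"
      unfolding eq by auto
    then show ?thesis
      using null_sets_completionI[OF null_sets_shear[OF null_sets_compl_diophantine[OF that], of pi]] by simp
  qed
qed

end
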